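(* Let $V$ be a finite-dimensional Euclidean space with Gaussian measure $d\mu$, and let $T_k:V_{\mathbb C}^{\otimes k}\to\mathbb{C}$, $k\ge 1$, be cyclically invariant linear maps. Let $x_1,x_2,\dots$ be variables and let $Z_{x_*}$ be the graphical calculus for the cyclic algebra $(V_{\mathbb C},(-,-),x_1T_1,x_2T_2,\dots)$. Then the following asymptotic expansion holds: $$\int_V\exp\Bigl\{\sum_{k=1}^\infty x_k\frac{T_k(v^{\otimes k})}{k}\Bigr\}\,d\mu(v)=\sum_{\Gamma\in R(0,0)}\frac{Z_{x_*}(\Gamma)}{|\mathrm{Aut}\,\Gamma|},$$ where the sum on the right ranges over the set $R(0,0)$ of all isomorphism classes of (possibly disconnected) ribbon graphs of type $(0,0)$. The equality is to be read as an identity of formal power series in $x_1,x_2,\dots$, the left-hand side being expanded in Taylor series in the $x_k$ and integrated term by term.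
   Context: $V_{\mathbb C}=V\otimes_{\mathbb R}\mathbb C$. The Gaussian measure on $V$ is the probability measure $d\mu(v)=\frac1A e^{-\frac12(v,v)}dv$, $A=\int_V e^{-\frac12(v,v)}dv$, with $dv$ a non-trivial translation invariant measure. A linear map $T_k:V_{\mathbb C}^{\otimes k}\to\mathbb C$ is cyclically invariant if $T_k(X_1\otimes\cdots\otimes X_k)=T_k(X_k\otimes X_1\otimes\cdots\otimes X_{k-1})$. A ribbon graph of type $(0,0)$ (no endpoints) is a finite graph, possibly disconnected or empty, with loops and multiple edges allowed, with a cyclic order on the half-edges at each vertex; vertices have any valence $\ge1$ and there are no vertexless circle components. Equivalently: a finite set $H$ of half-edges with a permutation $\sigma_0$ of $H$ (whose cycles are the vertices with their cyclic orders, fixed points being univalent vertices) and a fixed-point-free involution $\sigma_1$ of $H$ (whose orbits are the edges). Isomorphisms are bijections of half-edges commuting with $\sigma_0,\sigma_1$; $\mathrm{Aut}\,\Gamma$ is the group of automorphisms. Graphical calculus: for a cyclic algebra $(V_{\mathbb C},(-,-),A_1,A_2,\dots)$ and a ribbon graph $\Gamma$ of type $(0,0)$, the number $Z(\Gamma)$ is obtained by placing $A_k$ on each $k$-valent vertex (arguments in the cyclic order) and contracting along each edge with the Casimir element $\sum_i e_i\otimes e_i$, $\{e_i\}_{i=1}^d$ an orthonormal basis of $V$; i.e. $Z(\Gamma)=\sum_c\prod_v A_{k_v}(e_{c(h_1)}\otimes\cdots\otimes e_{c(h_{k_v})})$, where $c$ runs over maps from the set of edges to $\{1,\dots,d\}$,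 $h_1,\dots,h_{k_v}$ are the half-edges at the vertex $v$ listed in their cyclic order, and $c(h)$ is the value of $c$ on the edge containing $h$. The empty graph has value $1$. For $Z_{x_*}$ one takes $A_k=x_kT_k$. *)

theory Defs
  imports "HOL-Analysis.Analysis" "HOL-Combinatorics.Orbits" "HOL-Library.Multiset"
begin

section \<open>Formal power series in countably many variables\<close>

text \<open>The coefficient at the multiset \<open>m\<close> of variable indices belongs to the
  monomial \<open>\<Prod>k\<in>#m. x\<^sub>k\<close>. The variables are indexed by all natural numbers;
  \<open>x\<^sub>0\<close> is available but does not occur in the theorem.\<close>

datatype 'c mfps = MFPS (mfps_coeff: "nat multiset \<Rightarrow> 'c")

lemma mfps_eqI: "(\<And>m. mfps_coeff f m = mfps_coeff g m) \<Longrightarrow> f = g"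
  by (cases f; cases g) (auto intro: ext)

definition splits :: "nat multiset \<Rightarrow> (nat multiset \<times> nat multiset) set" where
  "splits m = {(a, b). a + b = m}"

lemma finite_splits [simp]: "finite (splits m)"
proof (induction m)
  case empty
  have "splits {#} = {({#}, {#})}" by (auto simp: splits_def)
  then show ?case by simp
next
  case (add x m)
  have "splits (add_mset x m) \<subseteq>
      (\<lambda>(a, b). (add_mset x a, b)) ` splits m \<union> (\<lambda>(a, b). (a, add_mset x b)) ` splits m"
  proof (rule subsetI)
    fix p assume "p \<in> splits (add_mset x m)"
    then obtain a b where p: "p = (a, b)" and ab: "a + b = add_mset x m"
      by (auto simp: splits_def)
    then have "x \<in># a \<or> x \<in># b"
      by (metis union_iff union_single_eq_member)
    then show "p \<in> (\<lambda>(a, b). (add_mset x a, b)) ` splits m \<union>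
        (\<lambda>(a, b). (a, add_mset x b)) ` splits m"
    proof
      assume "x \<in># a"
      then obtain a' where "a = add_mset x a'" by (metis insert_DiffM)
      then show ?thesis using p ab by (force simp: splits_def)
    next
      assume "x \<in># b"
      then obtain b' where "b = add_mset x b'" by (metis insert_DiffM)
      then show ?thesis using p ab by (force simp: splits_def)
    qed
  qed
  then show ?case
    using add.IH by (meson finite_UnI finite_imageI finite_subset)
qed

definition mfps_const :: "'c::zero \<Rightarrow> 'c mfps" where
  "mfps_const c = MFPS (\<lambda>m. if m = {#} then c else 0)"

definition mfps_var :: "nat \<Rightarrow> 'c::zero_neq_one mfps" where
  "mfps_var k = MFPS (\<lambda>m. if m = {#k#} then 1 else 0)"

instantiation mfps :: (comm_ring_1) comm_ring_1
begin

definition "0 = MFPS (\<lambda>m. 0)"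
definition "1 = mfps_const 1"
definition "f + g = MFPS (\<lambda>m. mfps_coeff f m + mfps_coeff g m)"
definition "f - g = MFPS (\<lambda>m. mfps_coeff f m - mfps_coeff g m)"
definition "- f = MFPS (\<lambda>m. - mfps_coeff f m)"
definition "f * g = MFPS (\<lambda>m. \<Sum>(a, b)\<in>splits m. mfps_coeff f a * mfps_coeff g b)"

instance
proof
  fix f g h :: "'a mfps"
  show "f + g + h = f + (g + h)" "f + g = g + f" "0 + f = f" "- f + f = 0" "f - g = f + - g"
    by (simp_all add: plus_mfps_def zero_mfps_def uminus_mfps_def minus_mfps_def add_ac)
  show "(0 :: 'a mfps) \<noteq> 1"
    by (auto simp: zero_mfps_def one_mfps_def mfps_const_def fun_eq_iff)
  show "(f + g) * h = f * h + g * h"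
    by (simp add: plus_mfps_def times_mfps_def distrib_right sum.distrib case_prod_unfold)
  show "f * g = g * f"
  proof (rule mfps_eqI)
    fix m
    show "mfps_coeff (f * g) m = mfps_coeff (g * f) m"
      unfolding times_mfps_def mfps.sel
      by (rule sum.reindex_bij_witness[where i = prod.swap and j = prod.swap])
         (auto simp: splits_def add.commute mult.commute)
  qed
  show "1 * f = f"
  proof (rule mfps_eqI)
    fix m
    have "mfps_coeff (1 * f) m = (\<Sum>p\<in>splits m. if p = ({#}, m) then mfps_coeff f m else 0)"
      unfolding times_mfps_def one_mfps_def mfps_const_def mfps.sel
      by (rule sum.cong) (auto simp: splits_def split: if_splits)
    also have "\<dots> = mfps_coeff f m"
    proof -
      have "({#}, m) \<in> splits m" by (simp add: splits_def)
      then show ?thesis by simp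
    qed
    finally show "mfps_coeff (1 * f) m = mfps_coeff f m" .
  qed
  show "f * g * h = f * (g * h)"
  proof (rule mfps_eqI)
    fix m
    have "mfps_coeff (f * g * h) m =
        (\<Sum>(p, q)\<in>(SIGMA p:splits m. splits (fst p)).
          mfps_coeff f (fst q) * mfps_coeff g (snd q) * mfps_coeff h (snd p))"
      by (simp add: times_mfps_def case_prod_unfold sum_distrib_right sum.Sigma)
    also have "\<dots> = (\<Sum>(p, q)\<in>(SIGMA p:splits m. splits (snd p)).
          mfps_coeff f (fst p) * (mfps_coeff g (fst q) * mfps_coeff h (snd q)))"
      by (rule sum.reindex_bij_witness
          [where j = "\<lambda>((a, b), (c, d)). ((c, d + b), (d, b))"
             and i = "\<lambda>((a, b), (c, d)). ((a + c, d), (a, c))"])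
         (auto simp: splits_def add_ac mult_ac)
    also have "\<dots> = mfps_coeff (f * (g * h)) m"
      by (simp add: times_mfps_def case_prod_unfold sum_distrib_left sum.Sigma)
    finally show "mfps_coeff (f * g * h) m = mfps_coeff (f * (g * h)) m" .
  qed
qed

end

text \<open>A family of power series has a formal sum if every monomial occurs in only finitely
  many members; the sum is then taken coefficientwise.\<close>

definition formally_summable :: "('i \<Rightarrow> 'c::comm_ring_1 mfps) \<Rightarrow> 'i set \<Rightarrow> bool" where
  "formally_summable F I \<longleftrightarrow> (\<forall>m. finite {i \<in> I. mfps_coeff (F i) m \<noteq> 0})"

definition formal_sum :: "('i \<Rightarrow> 'c::comm_ring_1 mfps) \<Rightarrow> 'i set \<Rightarrow> 'c mfps" where
  "formal_sum F I = MFPS (\<lambda>m. \<Sum>i \<in> {i \<in> I. mfps_coeff (F i) m \<noteq> 0}. mfps_coeff (F i) m)"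

text \<open>The exponential series, meaningful for series with constant coefficient \<open>0\<close>.\<close>

definition mfps_exp :: "'c::field_char_0 mfps \<Rightarrow> 'c mfps" where
  "mfps_exp f = formal_sum (\<lambda>n. mfps_const (1 / fact n) * f ^ n) UNIV"

definition termwise_integrable :: "'v measure \<Rightarrow> ('v \<Rightarrow> complex mfps) \<Rightarrow> bool" where
  "termwise_integrable M F \<longleftrightarrow> (\<forall>m. integrable M (\<lambda>v. mfps_coeff (F v) m))"

definition termwise_integral :: "'v measure \<Rightarrow> ('v \<Rightarrow> complex mfps) \<Rightarrow> complex mfps" where
  "termwise_integral M F = MFPS (\<lambda>m. \<integral>v. mfps_coeff (F v) m \<partial>M)"


section \<open>Euclidean spaces and the Gaussian measure\<close>

text \<open>A finite-dimensional Euclidean space is a type of class \<^class>\<open>real_inner\<close> that has a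
  finite orthonormal basis. Unlike \<^class>\<open>euclidean_space\<close>, this includes dimension \<open>0\<close>.\<close>

definition orthonormal_basis :: "'a::real_inner set \<Rightarrow> bool" where
  "orthonormal_basis B \<longleftrightarrow>
     finite B \<and> pairwise orthogonal B \<and> (\<forall>b\<in>B. norm b = 1) \<and> span B = UNIV"

text \<open>Non-trivial translation invariant measures are understood to be Borel and finite on
  compact sets; these are the positive multiples of Lebesgue measure.\<close>

definition translation_invariant_measure :: "'a::real_inner measure \<Rightarrow> bool" where
  "translation_invariant_measure dv \<longleftrightarrow>
     sets dv = sets borel \<and>
     (\<forall>a. distr dv borel (\<lambda>v. a + v) = dv) \<and>
     (\<forall>K. compact K \<longrightarrow> emeasure dv K < \<infinity>) \<and>
     emeasure dv (space dv) \<noteq> 0"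

definition gaussian_measure :: "'a::real_inner measure \<Rightarrow> 'a measure" where
  "gaussian_measure dv =
     (let A = (\<integral>v. exp (- (1/2) * (v \<bullet> v)) \<partial>dv)
      in density dv (\<lambda>v. ennreal (1 / A * exp (- (1/2) * (v \<bullet> v)))))"


section \<open>Complexification and cyclically invariant tensors\<close>

text \<open>The pair \<open>(u, w)\<close> stands for \<open>u + \<i> w\<close> in \<open>V \<otimes> \<complex>\<close>.\<close>

type_synonym 'a complexification = "'a \<times> 'a"

definition scaleCx :: "complex \<Rightarrow> 'a::real_vector complexification \<Rightarrow> 'a complexification" where
  "scaleCx c z =
     (Re c *\<^sub>R fst z - Im c *\<^sub>R snd z, Re c *\<^sub>R snd z + Im c *\<^sub>R fst z)"

definition of_real_vec :: "'a::real_vector \<Rightarrow> 'a complexification" where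
  "of_real_vec v = (v, 0)"

text \<open>By the universal property of the tensor product, complex linear maps on the \<open>k\<close>-th
  tensor power are complex \<open>k\<close>-linear maps; these are modelled as functions on lists whose
  values on lists of length other than \<open>k\<close> are irrelevant.\<close>

definition complex_multilinear ::
    "nat \<Rightarrow> ('a::real_vector complexification list \<Rightarrow> complex) \<Rightarrow> bool" where
  "complex_multilinear k T \<longleftrightarrow>
     (\<forall>X i y z c. length X = k \<and> i < k \<longrightarrow>
        T (X[i := y + z]) = T (X[i := y]) + T (X[i := z]) \<and>
        T (X[i := scaleCx c y]) = c * T (X[i := y]))"

definition cyclically_invariant :: "nat \<Rightarrow> ('b list \<Rightarrow> 'c) \<Rightarrow> bool" where
  "cyclically_invariant k T \<longleftrightarrow> (\<forall>X y. length (X @ [y]) = k \<longrightarrow> T (X @ [y]) = T (y # X))"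


section \<open>Ribbon graphs of type (0,0)\<close>

record 'h ribbon_graph =
  half_edges :: "'h set"
  vperm :: "'h \<Rightarrow> 'h"
  eperm :: "'h \<Rightarrow> 'h"

definition is_ribbon_graph :: "'h ribbon_graph \<Rightarrow> bool" where
  "is_ribbon_graph \<Gamma> \<longleftrightarrow>
     finite (half_edges \<Gamma>) \<and>
     vperm \<Gamma> permutes half_edges \<Gamma> \<and>
     eperm \<Gamma> permutes half_edges \<Gamma> \<and>
     (\<forall>h\<in>half_edges \<Gamma>. eperm \<Gamma> (eperm \<Gamma> h) = h \<and> eperm \<Gamma> h \<noteq> h)"

definition vertices :: "'h ribbon_graph \<Rightarrow> 'h set set" where
  "vertices \<Gamma> = orbit (vperm \<Gamma>) ` half_edges \<Gamma>"

definition edge_containing :: "'h ribbon_graph \<Rightarrow> 'h \<Rightarrow> 'h set" where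
  "edge_containing \<Gamma> h = {h, eperm \<Gamma> h}"

definition edges :: "'h ribbon_graph \<Rightarrow> 'h set set" where
  "edges \<Gamma> = edge_containing \<Gamma> ` half_edges \<Gamma>"

text \<open>The half-edges at \<open>v\<close> in their cyclic order, starting from an arbitrary one.\<close>

definition cyclic_list :: "'h ribbon_graph \<Rightarrow> 'h set \<Rightarrow> 'h list" where
  "cyclic_list \<Gamma> v = map (\<lambda>i. (vperm \<Gamma> ^^ i) (SOME h. h \<in> v)) [0..<card v]"

definition commutes_with_structure ::
    "'h ribbon_graph \<Rightarrow> 'h2 ribbon_graph \<Rightarrow> ('h \<Rightarrow> 'h2) \<Rightarrow> bool" where
  "commutes_with_structure \<Gamma> \<Gamma>' f \<longleftrightarrow>
     (\<forall>h\<in>half_edges \<Gamma>. f (vperm \<Gamma> h) = vperm \<Gamma>' (f h) \<and> f (eperm \<Gamma> h) = eperm \<Gamma>' (f h))"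

definition isomorphic :: "'h ribbon_graph \<Rightarrow> 'h2 ribbon_graph \<Rightarrow> bool" where
  "isomorphic \<Gamma> \<Gamma>' \<longleftrightarrow>
     (\<exists>f. bij_betw f (half_edges \<Gamma>) (half_edges \<Gamma>') \<and> commutes_with_structure \<Gamma> \<Gamma>' f)"

text \<open>Automorphisms are extended by the identity outside the half-edges, so that they can
  be counted.\<close>

definition Aut :: "'h ribbon_graph \<Rightarrow> ('h \<Rightarrow> 'h) set" where
  "Aut \<Gamma> = {f. f permutes half_edges \<Gamma> \<and> commutes_with_structure \<Gamma> \<Gamma> f}"

text \<open>Every finite ribbon graph is isomorphic to one whose half-edges are natural numbers.\<close>

definition R00 :: "nat ribbon_graph set set" where
  "R00 = {\<Gamma>. is_ribbon_graph \<Gamma>} //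
     {(\<Gamma>, \<Gamma>'). is_ribbon_graph \<Gamma> \<and> is_ribbon_graph \<Gamma>' \<and> isomorphic \<Gamma> \<Gamma>'}"

definition representative :: "nat ribbon_graph set \<Rightarrow> nat ribbon_graph" where
  "representative C = (SOME \<Gamma>. \<Gamma> \<in> C)"


section \<open>Graphical calculus\<close>

text \<open>The vertex tensors \<open>A k\<close> take values in a commutative ring, so that both numerical
  tensors and tensors with coefficients in a ring of power series are covered. The colouring
  \<open>c\<close> assigns basis vectors, rather than indices of basis vectors, to the edges.\<close>

definition graph_value ::
    "'a::real_inner set \<Rightarrow> (nat \<Rightarrow> 'a complexification list \<Rightarrow> 'r::comm_ring_1)
      \<Rightarrow> 'h ribbon_graph \<Rightarrow> 'r" where
  "graph_value B A \<Gamma> =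
     (\<Sum>c \<in> edges \<Gamma> \<rightarrow>\<^sub>E B. \<Prod>v\<in>vertices \<Gamma>.
        A (card v) (map (\<lambda>h. of_real_vec (c (edge_containing \<Gamma> h))) (cyclic_list \<Gamma> v)))"

definition Z_x ::
    "'a::real_inner set \<Rightarrow> (nat \<Rightarrow> 'a complexification list \<Rightarrow> 'c::comm_ring_1)
      \<Rightarrow> 'h ribbon_graph \<Rightarrow> 'c mfps" where
  "Z_x B T \<Gamma> = graph_value B (\<lambda>k X. mfps_var k * mfps_const (T k X)) \<Gamma>"

definition weight ::
    "'a::real_inner set \<Rightarrow> (nat \<Rightarrow> 'a complexification list \<Rightarrow> 'c::field_char_0)
      \<Rightarrow> 'h ribbon_graph \<Rightarrow> 'c mfps" where
  "weight B T \<Gamma> = mfps_const (1 / of_nat (card (Aut \<Gamma>))) * Z_x B T \<Gamma>"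

definition potential ::
    "(nat \<Rightarrow> 'a::real_vector complexification list \<Rightarrow> complex) \<Rightarrow> 'a \<Rightarrow> complex mfps" where
  "potential T v = formal_sum
     (\<lambda>k. mfps_var k * mfps_const (T k (replicate k (of_real_vec v)) / of_nat k)) {1..}"

end

theory Submission
  imports Defs
begin

text \<open>The coefficient of \<open>\<Prod>k\<in>#m. x\<^sub>k\<close> in the exponential of the potential is
  \<open>(\<Prod>k\<in>#m. T\<^sub>k(v\<^sup>k)) / z\<close>, where \<open>z = \<Prod> k\<^bsup>\<mu> k\<^esup> (\<mu> k)!\<close> and \<open>\<mu> k\<close> is the
  multiplicity of \<open>k\<close> in \<open>m\<close> (lemma \<open>coeff_exp_potential\<close>). The number \<open>z\<close> is also the order of
  the centralizer of a permutation \<open>\<sigma>\<close> of cycle type \<open>m\<close>. Read the numerator as a collection of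
  vertices: the cycles of \<open>\<sigma>\<close>, acting on a set \<open>H\<close> of half-edges, carry the tensors \<open>T\<^sub>k\<close>, and every
  half-edge carries the vector \<open>v\<close>.

  Expanding every \<open>v\<close> in an orthonormal basis and applying the Wick formula (lemma \<open>Wick\<close>) turns
  the Gaussian integral of the numerator into the sum, over all pairings \<open>\<pi>\<close> of \<open>H\<close>, of the
  graphical calculus of the ribbon graph \<open>(H, \<sigma>, \<pi>)\<close> (lemma \<open>integral_vertex_product\<close>).

  The centralizer of \<open>\<sigma>\<close> acts on the pairings by conjugation. Its orbits are the isomorphism
  classes of ribbon graphs with valences \<open>m\<close>, and its stabilizers are the automorphism groups. So a
  class is hit by \<open>z / |Aut \<Gamma>|\<close> pairings, and division by \<open>z\<close> leaves the weight \<open>1 / |Aut \<Gamma>|\<close>.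
  The orbit count is carried out by counting bijections that commute with the vertex permutations
  (theorem \<open>card_equivariant_bijections\<close> and lemma \<open>card_pairings_isomorphic\<close>). Cyclic invariance
  guarantees that the graphical calculus depends only on the class (lemma
  \<open>graph_value_isomorphic\<close>).

  The Wick formula is derived from translation invariance directly: differentiating the integral of
  a translated Gaussian times a polynomial gives an integration by parts, and hence a recursion for
  the moments which the numbers of pairings satisfy as well. The analytic input is that balls grow
  at most exponentially under a translation invariant measure that is finite on compact sets, so
  that the Gaussian has all exponential moments.\<close>

section \<open>Gaussian integrals for a translation invariant measure\<close>

locale invariant_measure_space =
  fixes B :: "'a::real_inner set" and dv :: "'a measure"
  assumes basis: "orthonormal_basis B"
    and invariant: "translation_invariant_measure dv"
begin

lemma finite_basis: "finite B"
  and norm_basis: "b \<in> B \<Longrightarrow> norm b = 1"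
  and orthogonal_basis: "pairwise orthogonal B"
  and span_basis: "span B = UNIV"
  using basis by (auto simp: orthonormal_basis_def)

lemma inner_basis: "a \<in> B \<Longrightarrow> b \<in> B \<Longrightarrow> a \<bullet> b = (if a = b then 1 else 0)"
  using orthogonal_basis norm_basis
  by (auto simp: pairwise_def orthogonal_def norm_eq_1)

lemma basis_expansion: "(\<Sum>b\<in>B. (v \<bullet> b) *\<^sub>R b) = v"
  by (rule orthonormal_basis_expand)
     (use finite_basis norm_basis orthogonal_basis span_basis in auto)

lemma abs_coordinate_le: "b \<in> B \<Longrightarrow> \<bar>v \<bullet> b\<bar> \<le> norm v"
  using Cauchy_Schwarz_ineq2[of v b] norm_basis[of b] by simp

text \<open>In a type of class \<^class>\<open>real_inner\<close> balls need not be compact; here they are, because a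
  ball is a closed subset of a box, and a box is an iterated sum of compact segments.\<close>

lemma compact_cball_basis: "compact (cball (0::'a) r)"
proof -
  have box: "compact {\<Sum>b\<in>F. t b *\<^sub>R b | t. \<forall>b\<in>F. t b \<in> {-r..r}}" if "finite F" for F :: "'a set"
    using that
  proof induction
    case empty
    then show ?case by simp
  next
    case (insert a F)
    have "compact ((\<lambda>s. s *\<^sub>R a) ` {-r..r})"
      by (intro compact_continuous_image continuous_intros compact_Icc)
    then have "compact {x + y | x y. x \<in> (\<lambda>s. s *\<^sub>R a) ` {-r..r} \<and>
        y \<in> {\<Sum>b\<in>F. t b *\<^sub>R b | t. \<forall>b\<in>F. t b \<in> {-r..r}}}"
      by (intro compact_sums insert.IH)
    also have "{x + y | x y. x \<in> (\<lambda>s. s *\<^sub>R a) ` {-r..r} \<and>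
        y \<in> {\<Sum>b\<in>F. t b *\<^sub>R b | t. \<forall>b\<in>F. t b \<in> {-r..r}}} =
        {\<Sum>b\<in>insert a F. t b *\<^sub>R b | t. \<forall>b\<in>insert a F. t b \<in> {-r..r}}" (is "?L = ?R")
    proof
      show "?L \<subseteq> ?R"
      proof
        fix z assume "z \<in> ?L"
        then obtain s t where z: "z = s *\<^sub>R a + (\<Sum>b\<in>F. t b *\<^sub>R b)" "s \<in> {-r..r}" "\<forall>b\<in>F. t b \<in> {-r..r}"
          by auto
        have "(\<Sum>b\<in>F. t b *\<^sub>R b) = (\<Sum>b\<in>F. (t(a := s)) b *\<^sub>R b)"
          using insert.hyps by (intro sum.cong) auto
        then have "z = (\<Sum>b\<in>insert a F. (t(a := s)) b *\<^sub>R b)"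
          using z insert.hyps by simp
        moreover have "\<forall>b\<in>insert a F. (t(a := s)) b \<in> {-r..r}" using z by auto
        ultimately show "z \<in> ?R" by blast
      qed
      show "?R \<subseteq> ?L"
      proof
        fix z assume "z \<in> ?R"
        then obtain t where "z = (\<Sum>b\<in>insert a F. t b *\<^sub>R b)" "\<forall>b\<in>insert a F. t b \<in> {-r..r}"
          by auto
        then have "z = t a *\<^sub>R a + (\<Sum>b\<in>F. t b *\<^sub>R b)" "t a \<in> {-r..r}" "\<forall>b\<in>F. t b \<in> {-r..r}"
          using insert.hyps by auto
        then show "z \<in> ?L" by blast
      qed
    qed
    finally show ?case .
  qed
  have "cball 0 r \<subseteq> {\<Sum>b\<in>B. t b *\<^sub>R b | t. \<forall>b\<in>B. t b \<in> {-r..r}}"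
  proof
    fix v :: 'a assume v: "v \<in> cball 0 r"
    have "\<forall>b\<in>B. v \<bullet> b \<in> {-r..r}"
      using v abs_coordinate_le[of _ v] by (force simp: abs_le_iff)
    then show "v \<in> {\<Sum>b\<in>B. t b *\<^sub>R b | t. \<forall>b\<in>B. t b \<in> {-r..r}}"
      using basis_expansion[of v] by (intro CollectI exI[of _ "\<lambda>b. v \<bullet> b"]) auto
  qed
  with box[OF finite_basis] have "compact ({\<Sum>b\<in>B. t b *\<^sub>R b | t. \<forall>b\<in>B. t b \<in> {-r..r}} \<inter> cball 0 r)"
    by (intro compact_Int_closed) auto
  with \<open>cball 0 r \<subseteq> _\<close> show ?thesis by (simp add: Int_absorb1)
qed

lemma sets_dv [measurable_cong, simp]: "sets dv = sets borel"
  and translate_dv: "distr dv borel (\<lambda>v. a + v) = dv"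
  and emeasure_compact: "compact K \<Longrightarrow> emeasure dv K < \<infinity>"
  and dv_nonzero: "emeasure dv (space dv) \<noteq> 0"
  using invariant by (auto simp: translation_invariant_measure_def)

lemma space_dv [simp]: "space dv = UNIV"
  using sets_eq_imp_space_eq[OF sets_dv] by simp

lemma continuous_measurable_dv:
  fixes f :: "'a \<Rightarrow> 'b::topological_space"
  assumes "continuous_on UNIV f"
  shows "f \<in> borel_measurable dv"
  using borel_measurable_continuous_onI[OF assms] by simp

lemma translation_measurable [measurable]: "(\<lambda>v. a + v) \<in> dv \<rightarrow>\<^sub>M borel"
  by (intro continuous_measurable_dv continuous_intros)

lemma emeasure_cball_translate: "emeasure dv (cball a r) = emeasure dv (cball 0 r)"
proof -
  have "emeasure dv (cball a r) = emeasure (distr dv borel (\<lambda>v. a + v)) (cball a r)"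
    by (simp add: translate_dv)
  also have "\<dots> = emeasure dv ((\<lambda>v. a + v) -` cball a r \<inter> space dv)"
    by (rule emeasure_distr) auto
  also have "(\<lambda>v. a + v) -` cball a r \<inter> space dv = cball 0 r"
    by (auto simp: dist_norm)
  finally show ?thesis .
qed

text \<open>Finiteness on compact sets alone does not make the Gaussian integrable; the growth of balls
  must be controlled. By compactness at most \<open>N\<close> unit balls cover the ball of radius \<open>2\<close>. The
  translates by their centres of the ball of radius \<open>r \<ge> 1\<close> then cover the ball of radius
  \<open>r + 1\<close>, so each step multiplies the measure at most by \<open>N\<close>.\<close>

lemma ball_growth:
  obtains C N where "C \<ge> 0" "N \<ge> (1::real)"
    "\<And>n. emeasure dv (cball 0 (real (Suc n))) \<le> ennreal (C * N ^ n)"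
proof -
  obtain X where X: "finite X" "cball (0::'a) 2 \<subseteq> (\<Union>x\<in>X. ball x 1)"
  proof (rule compactE_image[OF compact_cball_basis[of 2], of UNIV "\<lambda>x. ball x 1"])
    show "cball (0::'a) 2 \<subseteq> (\<Union>x\<in>UNIV. ball x 1)"
    proof
      fix x :: 'a
      have "x \<in> ball x 1" by simp
      then show "x \<in> (\<Union>x\<in>UNIV. ball x 1)" by blast
    qed
  qed auto
  define N where "N = real (card X) + 1"
  define C where "C = measure dv (cball 0 1)"
  have C: "emeasure dv (cball 0 1) = ennreal C"
    unfolding C_def using emeasure_compact[OF compact_cball_basis[of 1]]
    by (intro emeasure_eq_ennreal_measure) auto
  have cover: "cball (0::'a) (r + 1) \<subseteq> (\<Union>x\<in>X. cball x r)" if r: "r \<ge> 1" for r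
  proof
    fix v :: 'a assume "v \<in> cball 0 (r + 1)"
    then have v: "norm v \<le> r + 1" by simp
    \<comment> \<open>Split \<open>v\<close> into a piece of norm at most \<open>r - 1\<close> and a piece of norm at most \<open>2\<close>; only the
      second one is approximated by a centre, with error less than \<open>1\<close>.\<close>
    define u where "u = ((r - 1) / (r + 1)) *\<^sub>R v"
    define w where "w = (2 / (r + 1)) *\<^sub>R v"
    have uw: "v = u + w"
      unfolding u_def w_def scaleR_add_left[symmetric] using r
      by (simp add: add_divide_distrib[symmetric] add.commute)
    have "norm u = (r - 1) / (r + 1) * norm v" using r by (simp add: u_def)
    also have "\<dots> \<le> (r - 1) / (r + 1) * (r + 1)" using v r by (intro mult_left_mono) auto
    finally have u: "norm u \<le> r - 1" using r by simp
    have "norm w = 2 / (r + 1) * norm v" using r by (simp add: w_def)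
    also have "\<dots> \<le> 2 / (r + 1) * (r + 1)" using v r by (intro mult_left_mono) auto
    also have "\<dots> = 2"
      using r nonzero_eq_divide_eq[of "r + 1" "2 / (r + 1)" 2] by linarith
    finally have "w \<in> cball 0 2" by simp
    with X obtain x where x: "x \<in> X" "dist x w < 1" by auto
    have "dist x v \<le> dist x w + norm u"
      unfolding uw dist_norm using norm_triangle_ineq4[of "x - w" u] by (simp add: algebra_simps)
    with x u show "v \<in> (\<Union>x\<in>X. cball x r)" by force
  qed
  have "emeasure dv (cball 0 (real (Suc n))) \<le> ennreal (C * N ^ n)" for n
  proof (induction n)
    case 0
    then show ?case using C by simp
  next
    case (Suc n)
    have "emeasure dv (cball 0 (real (Suc (Suc n)))) \<le> emeasure dv (\<Union>x\<in>X. cball x (real (Suc n)))"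
      using cover[of "real (Suc n)"] X(1) by (intro emeasure_mono) (auto simp: add_ac)
    also have "\<dots> \<le> (\<Sum>x\<in>X. emeasure dv (cball x (real (Suc n))))"
      using X(1) by (intro emeasure_subadditive_finite) auto
    also have "\<dots> = of_nat (card X) * emeasure dv (cball 0 (real (Suc n)))"
      by (subst sum.cong[OF refl emeasure_cball_translate]) simp
    also have "\<dots> \<le> ennreal N * ennreal (C * N ^ n)"
      by (intro mult_mono Suc.IH) (auto simp: N_def ennreal_of_nat_eq_real_of_nat intro!: ennreal_leI)
    also have "\<dots> = ennreal (C * N ^ Suc n)"
      by (subst ennreal_mult[symmetric]) (auto simp: N_def C_def mult_ac)
    finally show ?case .
  qed
  moreover have "C \<ge> 0" "N \<ge> 1" by (auto simp: C_def N_def)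
  ultimately show ?thesis using that by blast
qed

definition gauss :: "'a \<Rightarrow> real" where
  "gauss v = exp (- (1/2) * (v \<bullet> v))"

lemma gauss_pos [simp]: "gauss v > 0" "gauss v \<ge> 0" "gauss v \<noteq> 0"
  by (simp_all add: gauss_def)

lemma gauss_measurable [measurable]: "gauss \<in> borel_measurable dv"
  unfolding gauss_def by (intro continuous_measurable_dv continuous_intros)

lemma norm_measurable [measurable]: "norm \<in> borel_measurable dv"
  by (intro continuous_measurable_dv continuous_intros)

lemma coordinate_measurable [measurable]: "(\<lambda>v. v \<bullet> b) \<in> borel_measurable dv"
  by (intro continuous_measurable_dv continuous_intros)

text \<open>The weight \<open>exp (c |v| - |v|\<^sup>2 / 2)\<close> decays faster than any exponential, in particular faster
  than \<open>(2 N) ^ -n\<close>, where \<open>N\<close> is the growth factor of the balls. Slicing the space at integer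
  radii therefore bounds the integral by a geometric series of ratio \<open>1/2\<close>.\<close>

lemma integrable_exp_gauss: "integrable dv (\<lambda>v. exp (c * norm v) * gauss v)"
proof -
  obtain C N where CN: "C \<ge> 0" "N \<ge> (1::real)"
    and growth: "\<And>n. emeasure dv (cball 0 (real (Suc n))) \<le> ennreal (C * N ^ n)"
    by (rule ball_growth) blast
  define L where "L = ln (2 * N)"
  define K where "K = exp ((c + L)\<^sup>2 / 2)"
  have L: "L \<ge> 0" "exp (- L) = 1 / (2 * N)"
    using CN by (auto simp: L_def exp_minus field_simps)
  have pointwise: "ennreal (exp (c * norm v) * gauss v) \<le>
      (\<Sum>n. ennreal (K * (1 / (2 * N)) ^ n) * indicator (cball 0 (real (Suc n))) v)" for v
  proof -
    \<comment> \<open>The single summand belonging to the integer part of the norm already dominates.\<close>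
    define n where "n = nat \<lfloor>norm v\<rfloor>"
    have n: "real n \<le> norm v" "norm v \<le> real (Suc n)"
      unfolding n_def by (simp_all add: of_nat_floor) (linarith)
    have "exp (c * norm v) * gauss v = exp (c * norm v - (norm v)\<^sup>2 / 2)"
      by (simp add: gauss_def exp_add[symmetric] power2_norm_eq_inner)
    also have "\<dots> \<le> exp ((c + L)\<^sup>2 / 2 - L * norm v)"
    proof -
      have "0 \<le> (norm v - (c + L))\<^sup>2" by simp
      then have "c * norm v - (norm v)\<^sup>2 / 2 \<le> (c + L)\<^sup>2 / 2 - L * norm v"
        by (simp add: power2_eq_square algebra_simps)
      then show ?thesis by simp
    qed
    also have "\<dots> \<le> exp ((c + L)\<^sup>2 / 2 - L * real n)"
      using n(1) L(1) by (simp add: mult_left_mono)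
    also have "\<dots> = K * (1 / (2 * N)) ^ n"
      unfolding K_def L(2)[symmetric] exp_of_nat_mult[symmetric] exp_add[symmetric]
      by (simp add: mult_ac)
    finally have "ennreal (exp (c * norm v) * gauss v) \<le>
        ennreal (K * (1 / (2 * N)) ^ n) * indicator (cball 0 (real (Suc n))) v"
      using n(2) by (auto intro: ennreal_leI)
    also have "\<dots> = (\<Sum>n\<in>{n}. ennreal (K * (1 / (2 * N)) ^ n) * indicator (cball 0 (real (Suc n))) v)"
      by (subst sum.insert) (simp_all del: of_nat_Suc)
    also have "\<dots> \<le> (\<Sum>n. ennreal (K * (1 / (2 * N)) ^ n) * indicator (cball 0 (real (Suc n))) v)"
      by (rule sum_le_suminf) auto
    finally show ?thesis .
  qed
  have "(\<integral>\<^sup>+v. ennreal (norm (exp (c * norm v) * gauss v)) \<partial>dv) \<le>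
      (\<integral>\<^sup>+v. (\<Sum>n. ennreal (K * (1 / (2 * N)) ^ n) * indicator (cball 0 (real (Suc n))) v) \<partial>dv)"
    using pointwise by (intro nn_integral_mono) simp
  also have "\<dots> = (\<Sum>n. \<integral>\<^sup>+v. ennreal (K * (1 / (2 * N)) ^ n) * indicator (cball 0 (real (Suc n))) v \<partial>dv)"
    by (intro nn_integral_suminf borel_measurable_times_ennreal borel_measurable_indicator) auto
  also have "\<dots> = (\<Sum>n. ennreal (K * (1 / (2 * N)) ^ n) * emeasure dv (cball 0 (real (Suc n))))"
    by (intro suminf_cong nn_integral_cmult_indicator) auto
  also have "\<dots> \<le> (\<Sum>n. ennreal (K * C * (1 / 2) ^ n))"
  proof (intro suminf_le)
    fix n
    have "ennreal (K * (1 / (2 * N)) ^ n) * emeasure dv (cball 0 (real (Suc n))) \<le>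
        ennreal (K * (1 / (2 * N)) ^ n) * ennreal (C * N ^ n)"
      by (intro mult_left_mono growth) auto
    also have "\<dots> = ennreal (K * C * (1 / 2) ^ n)"
      using CN by (subst ennreal_mult[symmetric]) (auto simp: K_def field_simps)
    finally show "ennreal (K * (1 / (2 * N)) ^ n) * emeasure dv (cball 0 (real (Suc n))) \<le>
        ennreal (K * C * (1 / 2) ^ n)" .
  qed auto
  also have "\<dots> = ennreal (\<Sum>n. K * C * (1 / 2) ^ n)"
    using CN by (intro suminf_ennreal2 summable_mult summable_geometric) (auto simp: K_def)
  also have "\<dots> < \<infinity>" by simp
  finally show ?thesis
    by (intro integrableI_bounded) auto
qed

lemma integrable_dominated:
  fixes f :: "'a \<Rightarrow> real"
  assumes "f \<in> borel_measurable dv" "\<And>v. \<bar>f v\<bar> \<le> exp (c * norm v)"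
  shows "integrable dv (\<lambda>v. f v * gauss v)"
proof (rule Bochner_Integration.integrable_bound[OF integrable_exp_gauss[of c]])
  show "(\<lambda>v. f v * gauss v) \<in> borel_measurable dv"
    using assms(1) by measurable
  show "AE v in dv. norm (f v * gauss v) \<le> norm (exp (c * norm v) * gauss v)"
    using assms(2) by (intro AE_I2) (simp add: abs_mult)
qed

lemma integral_translate:
  fixes f :: "'a \<Rightarrow> real"
  assumes "f \<in> borel_measurable dv"
  shows "(\<integral>v. f (a + v) \<partial>dv) = (\<integral>v. f v \<partial>dv)"
proof -
  have "(\<integral>v. f v \<partial>dv) = (\<integral>v. f v \<partial>distr dv borel (\<lambda>v. a + v))"
    by (simp add: translate_dv)
  also have "\<dots> = (\<integral>v. f (a + v) \<partial>dv)"
    using assms by (intro integral_distr) auto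
  finally show ?thesis by simp
qed

definition total_mass :: real where "total_mass = (\<integral>v. gauss v \<partial>dv)"

lemma integrable_gauss: "integrable dv gauss"
  using integrable_exp_gauss[of 0] by simp

lemma total_mass_pos: "total_mass > 0"
proof -
  have "\<not> (AE v in dv. gauss v = 0)"
    using dv_nonzero by (simp add: AE_iff_null null_sets_def)
  then have "total_mass \<noteq> 0"
    unfolding total_mass_def
    using integral_nonneg_eq_0_iff_AE[OF integrable_gauss] by simp
  moreover have "total_mass \<ge> 0" unfolding total_mass_def by (intro integral_nonneg_AE) auto
  ultimately show ?thesis by simp
qed

text \<open>The derivative of the exponential factor at \<open>t = 0\<close> is \<open>- (v \<bullet> b)\<close>; it supplies the additional
  coordinate in the integration by parts below.\<close>

lemma gauss_translate: "b \<in> B \<Longrightarrow> gauss (t *\<^sub>R b + v) = exp (- (t * (v \<bullet> b)) - t\<^sup>2 / 2) * gauss v"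
  by (simp add: gauss_def exp_add[symmetric] inner_add_left inner_add_right inner_basis inner_commute
      power2_eq_square algebra_simps)

lemma abs_coordinate_le_exp: "b \<in> B \<Longrightarrow> \<bar>v \<bullet> b\<bar> \<le> exp (norm v)"
  using abs_coordinate_le[of b v] exp_ge_add_one_self[of "norm v"] by linarith

lemma integrable_coordinate_power:
  assumes b: "b \<in> B" and h: "h \<in> borel_measurable dv" "\<And>v. \<bar>h v\<bar> \<le> exp (c * norm v)"
  shows "integrable dv (\<lambda>v. h v * (v \<bullet> b) ^ n * gauss v)"
proof (rule integrable_dominated[where c = "c + real n"])
  show "(\<lambda>v. h v * (v \<bullet> b) ^ n) \<in> borel_measurable dv" using h(1) by measurable
  fix v
  have "\<bar>h v * (v \<bullet> b) ^ n\<bar> \<le> exp (c * norm v) * exp (norm v) ^ n"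
    unfolding abs_mult power_abs using abs_coordinate_le_exp[OF b]
    by (intro mult_mono h power_mono) auto
  then show "\<bar>h v * (v \<bullet> b) ^ n\<bar> \<le> exp ((c + real n) * norm v)"
    by (simp add: exp_of_nat_mult[symmetric] exp_add[symmetric] algebra_simps)
qed

text \<open>Translation invariance makes \<open>\<integral> F (v + t b) dv\<close> constant in \<open>t\<close>, for the integrand
  \<open>F v = h v (v \<bullet> b)\<^sup>n gauss v\<close>. The derivative at \<open>t = 0\<close>, taken under the integral sign, is
  the claim. The derivative is computed along the sequence \<open>t = 1 / (k + 1)\<close>, so that dominated
  convergence applies; the dominating function comes from the mean value theorem.\<close>

lemma gaussian_integration_by_parts:
  assumes b: "b \<in> B"
    and h: "h \<in> borel_measurable dv" "\<And>v. \<bar>h v\<bar> \<le> exp (c * norm v)"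
    and h_const: "\<And>t v. h (t *\<^sub>R b + v) = h v"
  shows "(\<integral>v. h v * (v \<bullet> b) ^ Suc n * gauss v \<partial>dv) =
    real n * (\<integral>v. h v * (v \<bullet> b) ^ (n - 1) * gauss v \<partial>dv)"
proof -
  \<comment> \<open>After the shift by \<open>t b\<close> the integrand is \<open>h v * \<phi> (v \<bullet> b) t * gauss v\<close>.\<close>
  define \<phi> where "\<phi> x t = (x + t) ^ n * exp (- (t * x) - t\<^sup>2 / 2)" for x t :: real
  define \<phi>' where "\<phi>' x t = (real n * (x + t) ^ (n - 1) - (x + t) ^ Suc n) * exp (- (t * x) - t\<^sup>2 / 2)"
    for x t :: real
  have deriv: "(\<phi> x has_field_derivative \<phi>' x t) (at t)" for x t
    unfolding \<phi>_def \<phi>'_def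
    by (rule derivative_eq_intros refl | simp)+ (simp add: algebra_simps)
  define e :: "nat \<Rightarrow> real" where "e k = 1 / real (Suc k)" for k
  have e: "0 < e k" "e k \<le> 1" for k by (auto simp: e_def)
  have e0: "e \<longlonglongrightarrow> 0" unfolding e_def using LIMSEQ_Suc[OF lim_1_over_n] by simp
  define s where "s k v = h v * ((\<phi> (v \<bullet> b) (e k) - \<phi> (v \<bullet> b) 0) / e k) * gauss v" for k v
  define f where "f v = h v * \<phi>' (v \<bullet> b) 0 * gauss v" for v
  define M where "M = real n + 1"
  have F: "(\<lambda>v. h v * (v \<bullet> b) ^ n * gauss v) \<in> borel_measurable dv"
    using h(1) by measurable
  have translated: "h v * \<phi> (v \<bullet> b) t * gauss v =
      h (t *\<^sub>R b + v) * ((t *\<^sub>R b + v) \<bullet> b) ^ n * gauss (t *\<^sub>R b + v)" for v t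
    unfolding gauss_translate[OF b] h_const \<phi>_def
    by (simp add: inner_add_left inner_basis b mult_ac add_ac)
  have int_\<phi>: "integrable dv (\<lambda>v. h v * \<phi> (v \<bullet> b) t * gauss v)" for t
  proof -
    have "integrable (distr dv borel (\<lambda>v. t *\<^sub>R b + v)) (\<lambda>v. h v * (v \<bullet> b) ^ n * gauss v)"
      unfolding translate_dv by (rule integrable_coordinate_power[OF b h])
    then show ?thesis unfolding translated
      by (rule integrable_distr[rotated]) auto
  qed
  have "(\<integral>v. s k v \<partial>dv) = 0" for k
  proof -
    have "(\<integral>v. h v * \<phi> (v \<bullet> b) t * gauss v \<partial>dv) = (\<integral>v. h v * (v \<bullet> b) ^ n * gauss v \<partial>dv)" for t
      unfolding translated by (rule integral_translate[OF F])
    then have "(\<integral>v. (h v * \<phi> (v \<bullet> b) (e k) * gauss v - h v * \<phi> (v \<bullet> b) 0 * gauss v) \<partial>dv) = 0"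
      by (subst Bochner_Integration.integral_diff) (use int_\<phi> in auto)
    then have "(\<integral>v. (h v * \<phi> (v \<bullet> b) (e k) * gauss v - h v * \<phi> (v \<bullet> b) 0 * gauss v) / e k \<partial>dv) = 0"
      by simp
    then show ?thesis by (simp add: s_def algebra_simps diff_divide_distrib)
  qed
  moreover have "(\<lambda>k. \<integral>v. s k v \<partial>dv) \<longlonglongrightarrow> (\<integral>v. f v \<partial>dv)"
  proof (rule integral_dominated_convergence)
    show "f \<in> borel_measurable dv" "s k \<in> borel_measurable dv" for k
      unfolding f_def s_def \<phi>_def \<phi>'_def using h(1) by measurable
    show "integrable dv (\<lambda>v. M * (exp ((c + real n + 2) * norm v) * gauss v))"
      by (intro integrable_mult_right integrable_exp_gauss)
    show "AE v in dv. (\<lambda>k. s k v) \<longlonglongrightarrow> f v"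
    proof (rule AE_I2)
      fix v
      have "((\<lambda>t. (\<phi> (v \<bullet> b) t - \<phi> (v \<bullet> b) 0) / t) \<longlongrightarrow> \<phi>' (v \<bullet> b) 0) (at 0)"
        using deriv[of "v \<bullet> b" 0] by (simp add: has_field_derivative_iff)
      moreover have "filterlim e (at 0) sequentially"
        using e0 e(1) by (intro filterlim_atI) (auto simp: less_imp_neq[symmetric])
      ultimately have "(\<lambda>k. (\<phi> (v \<bullet> b) (e k) - \<phi> (v \<bullet> b) 0) / e k) \<longlonglongrightarrow> \<phi>' (v \<bullet> b) 0"
        by (rule filterlim_compose)
      then show "(\<lambda>k. s k v) \<longlonglongrightarrow> f v"
        unfolding s_def f_def by (intro tendsto_intros)
    qed
    fix k
    show "AE v in dv. norm (s k v) \<le> M * (exp ((c + real n + 2) * norm v) * gauss v)"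
    proof (rule AE_I2)
      fix v
      define x where "x = v \<bullet> b"
      define r where "r = norm v"
      have x: "\<bar>x\<bar> \<le> r" and r: "r \<ge> 0"
        using abs_coordinate_le[OF b] by (auto simp: x_def r_def)
      obtain z where z: "0 < z" "z < e k" "\<phi> x (e k) - \<phi> x 0 = (e k - 0) * \<phi>' x z"
        using MVT2[of 0 "e k" "\<phi> x" "\<phi>' x"] deriv e(1) by blast
      have z1: "z < 1" using z(2) e(2)[of k] by linarith
      have "\<bar>x + z\<bar> \<le> exp r"
        using x z(1) z1 exp_ge_add_one_self[of r] by linarith
      then have pow: "\<bar>x + z\<bar> ^ m \<le> exp (real m * r)" for m
        by (simp add: exp_of_nat_mult power_mono)
      have "\<bar>\<phi>' x z\<bar> = \<bar>real n * (x + z) ^ (n - 1) - (x + z) ^ Suc n\<bar> * exp (- (z * x) - z\<^sup>2 / 2)"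
        by (simp add: \<phi>'_def abs_mult)
      also have "\<dots> \<le> ((real n + 1) * exp ((real n + 1) * r)) * exp r"
      proof (intro mult_mono)
        have "\<bar>real n * (x + z) ^ (n - 1) - (x + z) ^ Suc n\<bar> \<le> real n * \<bar>x + z\<bar> ^ (n - 1) + \<bar>x + z\<bar> ^ Suc n"
          by (rule order_trans[OF abs_triangle_ineq4]) (simp add: abs_mult power_abs)
        also have "\<dots> \<le> real n * exp (real (n - 1) * r) + exp (real (Suc n) * r)"
          by (intro add_mono mult_left_mono pow) auto
        also have "\<dots> \<le> real n * exp ((real n + 1) * r) + exp ((real n + 1) * r)"
          using r by (intro add_mono mult_left_mono) (auto simp: add_ac intro!: mult_right_mono)
        finally show "\<bar>real n * (x + z) ^ (n - 1) - (x + z) ^ Suc n\<bar> \<le> (real n + 1) * exp ((real n + 1) * r)"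
          by (simp add: algebra_simps)
        have "z * \<bar>x\<bar> \<le> 1 * r" using x z(1) z1 r by (intro mult_mono) auto
        then have "- (z * x) \<le> r" using z(1) by (smt (verit) mult_minus_right mult_left_mono)
        then have "- (z * x) - z\<^sup>2 / 2 \<le> r"
          using zero_le_power2[of z] by linarith
        then show "exp (- (z * x) - z\<^sup>2 / 2) \<le> exp r" by simp
      qed auto
      also have "\<dots> = (real n + 1) * exp ((real n + 2) * r)"
        by (simp add: exp_add[symmetric] algebra_simps)
      finally have "\<bar>\<phi>' x z\<bar> \<le> M * exp ((real n + 2) * r)"
        by (simp add: M_def)
      moreover have "s k v = h v * \<phi>' x z * gauss v"
        using z(3) e(1)[of k] by (simp add: s_def x_def)
      ultimately have "\<bar>s k v\<bar> \<le> exp (c * norm v) * (M * exp ((real n + 2) * r)) * gauss v"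
        using h(2)[of v] by (auto simp: abs_mult M_def intro!: mult_mono)
      also have "exp (c * norm v) * (M * exp ((real n + 2) * r)) =
          M * (exp (c * norm v) * exp ((real n + 2) * r))"
        by simp
      also have "exp (c * norm v) * exp ((real n + 2) * r) = exp ((c + real n + 2) * norm v)"
        by (simp add: r_def exp_add[symmetric] distrib_right)
      finally show "norm (s k v) \<le> M * (exp ((c + real n + 2) * norm v) * gauss v)"
        by (simp add: mult.assoc)
    qed
  qed
  ultimately have "(\<integral>v. f v \<partial>dv) = 0"
    by (simp add: LIMSEQ_const_iff)
  moreover have "f v = real n * (h v * (v \<bullet> b) ^ (n - 1) * gauss v) - h v * (v \<bullet> b) ^ Suc n * gauss v" for v
    by (simp add: f_def \<phi>'_def algebra_simps)
  ultimately show ?thesis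
    using integrable_coordinate_power[OF b h, of "n - 1"] integrable_coordinate_power[OF b h, of "Suc n"]
    by (simp del: power_Suc)
qed

text \<open>Pull out all factors \<open>v \<bullet> b\<close> with \<open>b = c i0\<close>: the remaining product does not change under
  translations along \<open>b\<close>. Integration by parts replaces the \<open>(n + 1)\<close>-st power of \<open>v \<bullet> b\<close> by
  \<open>n\<close> times the \<open>(n - 1)\<close>-st power. The factor \<open>n\<close> counts the possible partners \<open>j\<close> of \<open>i0\<close>.\<close>

lemma Wick_recursion:
  assumes I: "finite I" "i0 \<in> I" and c: "\<And>i. i \<in> I \<Longrightarrow> c i \<in> B"
  shows "(\<integral>v. (\<Prod>i\<in>I. v \<bullet> c i) * gauss v \<partial>dv) =
    (\<Sum>j\<in>{j \<in> I - {i0}. c j = c i0}. \<integral>v. (\<Prod>i\<in>I - {i0, j}. v \<bullet> c i) * gauss v \<partial>dv)"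
proof -
  define b where "b = c i0"
  define P where "P = {i \<in> I. c i = b}"
  define h where "h v = (\<Prod>i\<in>I - P. v \<bullet> c i)" for v
  define n where "n = card (P - {i0})"
  have b: "b \<in> B" using I c by (auto simp: b_def)
  have P: "finite P" "i0 \<in> P" "P \<subseteq> I" using I by (auto simp: P_def b_def)
  have card_P: "card P = Suc n"
    unfolding n_def using P by (metis card.remove)
  have h_meas: "h \<in> borel_measurable dv"
    unfolding h_def by measurable
  have h_bound: "\<bar>h v\<bar> \<le> exp (real (card (I - P)) * norm v)" for v
  proof -
    have "\<bar>h v\<bar> \<le> (\<Prod>i\<in>I - P. exp (norm v))"
      unfolding h_def abs_prod using c by (intro prod_mono) (auto intro: abs_coordinate_le_exp)
    then show ?thesis by (simp add: exp_of_nat_mult)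
  qed
  have h_const: "h (t *\<^sub>R b + v) = h v" for t v
    unfolding h_def using c b by (intro prod.cong) (auto simp: inner_add_left inner_basis P_def)
  have split: "(\<Prod>i\<in>I - J. v \<bullet> c i) = h v * (v \<bullet> b) ^ (card P - card J)" if "J \<subseteq> P" for J v
  proof -
    have "(\<Prod>i\<in>I - J. v \<bullet> c i) = (\<Prod>i\<in>(I - P) \<union> (P - J). v \<bullet> c i)"
      using that P by (intro prod.cong) auto
    also have "\<dots> = h v * (\<Prod>i\<in>P - J. v \<bullet> c i)"
      unfolding h_def using I P by (intro prod.union_disjoint) auto
    also have "(\<Prod>i\<in>P - J. v \<bullet> c i) = (\<Prod>i\<in>P - J. v \<bullet> b)"
      by (intro prod.cong) (auto simp: P_def)
    also have "\<dots> = (v \<bullet> b) ^ (card P - card J)"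
      using that P by (simp add: card_Diff_subset finite_subset)
    finally show ?thesis .
  qed
  have "(\<integral>v. (\<Prod>i\<in>I. v \<bullet> c i) * gauss v \<partial>dv) = (\<integral>v. h v * (v \<bullet> b) ^ Suc n * gauss v \<partial>dv)"
    using split[of "{}"] by (simp add: card_P)
  also have "\<dots> = real n * (\<integral>v. h v * (v \<bullet> b) ^ (n - 1) * gauss v \<partial>dv)"
    by (rule gaussian_integration_by_parts[OF b h_meas h_bound h_const])
  also have "\<dots> = (\<Sum>j\<in>P - {i0}. \<integral>v. h v * (v \<bullet> b) ^ (n - 1) * gauss v \<partial>dv)"
    by (simp add: n_def)
  also have "\<dots> = (\<Sum>j\<in>P - {i0}. \<integral>v. (\<Prod>i\<in>I - {i0, j}. v \<bullet> c i) * gauss v \<partial>dv)"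
  proof (intro sum.cong refl)
    fix j assume j: "j \<in> P - {i0}"
    then have "card {i0, j} = 2" by (auto simp: card_insert_if)
    then show "(\<integral>v. h v * (v \<bullet> b) ^ (n - 1) * gauss v \<partial>dv) =
        (\<integral>v. (\<Prod>i\<in>I - {i0, j}. v \<bullet> c i) * gauss v \<partial>dv)"
      using j P split[of "{i0, j}"] by (simp add: card_P)
  qed
  also have "P - {i0} = {j \<in> I - {i0}. c j = c i0}" by (auto simp: P_def b_def)
  finally show ?thesis .
qed

end

section \<open>Pairings and the Wick formula\<close>

definition pairings :: "'i set \<Rightarrow> ('i \<Rightarrow> 'i) set" where
  "pairings I = {\<pi>. \<pi> permutes I \<and> (\<forall>i\<in>I. \<pi> (\<pi> i) = i \<and> \<pi> i \<noteq> i)}"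

lemma finite_pairings: "finite I \<Longrightarrow> finite (pairings I)"
  unfolding pairings_def by (rule finite_subset[OF _ finite_permutations[of I]]) auto

text \<open>By orthonormality only those pairings contribute to a Gaussian moment that join equal
  basis vectors.\<close>

definition compatible_pairings :: "'i set \<Rightarrow> ('i \<Rightarrow> 'c) \<Rightarrow> ('i \<Rightarrow> 'i) set" where
  "compatible_pairings I c = {\<pi> \<in> pairings I. \<forall>i\<in>I. c (\<pi> i) = c i}"

lemma finite_compatible_pairings: "finite I \<Longrightarrow> finite (compatible_pairings I c)"
  unfolding compatible_pairings_def by (simp add: finite_pairings)

lemma compatible_pairings_empty: "compatible_pairings {} c = {id}"
  by (auto simp: compatible_pairings_def pairings_def)

text \<open>Composing with the transposition of \<open>i0\<close> and \<open>j\<close> splits off this pair, and composing once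
  more restores it.\<close>

lemma card_compatible_pairings_partner:
  assumes ij: "i0 \<in> I" "j \<in> I" "j \<noteq> i0" "c j = c i0"
  shows "card {\<pi> \<in> compatible_pairings I c. \<pi> i0 = j} = card (compatible_pairings (I - {i0, j}) c)"
proof (rule bij_betw_same_card)
  let ?\<tau> = "Transposition.transpose i0 j"
  have drop: "\<pi> \<circ> ?\<tau> \<in> compatible_pairings (I - {i0, j}) c"
    if \<pi>: "\<pi> \<in> compatible_pairings I c" "\<pi> i0 = j" for \<pi>
  proof -
    have perm: "\<pi> permutes I" and inv: "\<And>i. i \<in> I \<Longrightarrow> \<pi> (\<pi> i) = i" "\<And>i. i \<in> I \<Longrightarrow> \<pi> i \<noteq> i"
      and col: "\<And>i. i \<in> I \<Longrightarrow> c (\<pi> i) = c i"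
      using \<pi> by (auto simp: compatible_pairings_def pairings_def)
    have \<pi>j: "\<pi> j = i0" using inv(1)[of i0] ij \<pi> by simp
    have "\<pi> \<circ> ?\<tau> permutes I"
      by (intro permutes_compose perm permutes_swap_id ij)
    moreover have "(\<pi> \<circ> ?\<tau>) x = x" if "x \<notin> I - {i0, j}" for x
      using that \<pi>(2) \<pi>j perm ij by (auto simp: Transposition.transpose_def permutes_def)
    ultimately have "\<pi> \<circ> ?\<tau> permutes I - {i0, j}"
      by (auto simp: permutes_def)
    moreover have "(\<pi> \<circ> ?\<tau>) i = \<pi> i" "(\<pi> \<circ> ?\<tau>) (\<pi> i) = i" if "i \<in> I - {i0, j}" for i
    proof -
      show "(\<pi> \<circ> ?\<tau>) i = \<pi> i" using that by (auto simp: Transposition.transpose_def)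
      have "\<pi> i \<noteq> i0" "\<pi> i \<noteq> j"
        using that inv(1)[of i] \<pi>(2) \<pi>j by auto
      then show "(\<pi> \<circ> ?\<tau>) (\<pi> i) = i" using that inv(1) by (auto simp: Transposition.transpose_def)
    qed
    ultimately show ?thesis
      using inv col by (auto simp: compatible_pairings_def pairings_def)
  qed
  have extend: "\<pi> \<circ> ?\<tau> \<in> compatible_pairings I c" "(\<pi> \<circ> ?\<tau>) i0 = j"
    if \<pi>: "\<pi> \<in> compatible_pairings (I - {i0, j}) c" for \<pi>
  proof -
    have perm: "\<pi> permutes I - {i0, j}"
      and inv: "\<And>i. i \<in> I - {i0, j} \<Longrightarrow> \<pi> (\<pi> i) = i" "\<And>i. i \<in> I - {i0, j} \<Longrightarrow> \<pi> i \<noteq> i"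
      and col: "\<And>i. i \<in> I - {i0, j} \<Longrightarrow> c (\<pi> i) = c i"
      using \<pi> by (auto simp: compatible_pairings_def pairings_def)
    have fixed: "\<pi> i0 = i0" "\<pi> j = j" using perm by (auto simp: permutes_def)
    show "(\<pi> \<circ> ?\<tau>) i0 = j" using fixed by simp
    have "\<pi> \<circ> ?\<tau> permutes I"
      by (intro permutes_compose permutes_subset[OF perm] permutes_swap_id ij) auto
    moreover have "(\<pi> \<circ> ?\<tau>) ((\<pi> \<circ> ?\<tau>) i) = i \<and> (\<pi> \<circ> ?\<tau>) i \<noteq> i \<and> c ((\<pi> \<circ> ?\<tau>) i) = c i"
      if i: "i \<in> I" for i
    proof (cases "i \<in> {i0, j}")
      case True
      then show ?thesis using fixed ij by auto
    next
      case False
      then have i': "i \<in> I - {i0, j}" using i by simp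
      then have "\<pi> i \<in> I - {i0, j}" using permutes_in_image[OF perm] by simp
      then show ?thesis using i' inv col by (auto simp: Transposition.transpose_def)
    qed
    ultimately show "\<pi> \<circ> ?\<tau> \<in> compatible_pairings I c"
      by (auto simp: compatible_pairings_def pairings_def)
  qed
  show "bij_betw (\<lambda>\<pi>. \<pi> \<circ> ?\<tau>) {\<pi> \<in> compatible_pairings I c. \<pi> i0 = j} (compatible_pairings (I - {i0, j}) c)"
    by (rule bij_betw_byWitness[where f' = "\<lambda>\<pi>. \<pi> \<circ> ?\<tau>"])
       (use drop extend in \<open>auto simp: comp_assoc\<close>)
qed

lemma card_compatible_pairings_recursion:
  assumes I: "finite I" "i0 \<in> I"
  shows "card (compatible_pairings I c) =
    (\<Sum>j\<in>{j \<in> I - {i0}. c j = c i0}. card (compatible_pairings (I - {i0, j}) c))"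
proof -
  have "compatible_pairings I c = (\<Union>j\<in>{j \<in> I - {i0}. c j = c i0}. {\<pi> \<in> compatible_pairings I c. \<pi> i0 = j})"
    using I by (auto simp: compatible_pairings_def pairings_def permutes_in_image)
  also have "card \<dots> = (\<Sum>j\<in>{j \<in> I - {i0}. c j = c i0}. card {\<pi> \<in> compatible_pairings I c. \<pi> i0 = j})"
    using I finite_compatible_pairings[of I c] by (intro card_UN_disjoint) auto
  also have "\<dots> = (\<Sum>j\<in>{j \<in> I - {i0}. c j = c i0}. card (compatible_pairings (I - {i0, j}) c))"
    using I by (intro sum.cong refl card_compatible_pairings_partner) auto
  finally show ?thesis .
qed

context invariant_measure_space
begin

text \<open>Wick's formula for products of coordinates: moments and numbers of compatible pairings satisfy
  the same recursion.\<close>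

lemma Wick_unnormalized:
  assumes "finite I" "\<And>i. i \<in> I \<Longrightarrow> c i \<in> B"
  shows "(\<integral>v. (\<Prod>i\<in>I. v \<bullet> c i) * gauss v \<partial>dv) = total_mass * real (card (compatible_pairings I c))"
  using assms
proof (induction "card I" arbitrary: I rule: less_induct)
  case less
  show ?case
  proof (cases "I = {}")
    case True
    then show ?thesis by (simp add: compatible_pairings_empty total_mass_def)
  next
    case False
    then obtain i0 where i0: "i0 \<in> I" by auto
    have "(\<integral>v. (\<Prod>i\<in>I. v \<bullet> c i) * gauss v \<partial>dv) =
      (\<Sum>j\<in>{j \<in> I - {i0}. c j = c i0}. \<integral>v. (\<Prod>i\<in>I - {i0, j}. v \<bullet> c i) * gauss v \<partial>dv)"
      by (rule Wick_recursion) (use less i0 in auto)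
    also have "\<dots> = (\<Sum>j\<in>{j \<in> I - {i0}. c j = c i0}. total_mass * real (card (compatible_pairings (I - {i0, j}) c)))"
      using less i0 by (intro sum.cong refl less.hyps psubset_card_mono) auto
    also have "\<dots> = total_mass * real (card (compatible_pairings I c))"
      using less i0 by (simp add: card_compatible_pairings_recursion[of I i0] sum_distrib_left)
    finally show ?thesis .
  qed
qed

lemma integrable_gaussian_measure:
  fixes f :: "'a \<Rightarrow> real"
  assumes "f \<in> borel_measurable dv" "integrable dv (\<lambda>v. f v * gauss v)"
  shows "integrable (gaussian_measure dv) f"
    and "(\<integral>v. f v \<partial>gaussian_measure dv) = (\<integral>v. f v * gauss v \<partial>dv) / total_mass"
proof -
  have eq: "gaussian_measure dv = density dv (\<lambda>v. ennreal (1 / total_mass * gauss v))"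
    by (simp add: gaussian_measure_def total_mass_def gauss_def)
  have nn: "AE v in dv. 0 \<le> 1 / total_mass * gauss v" using total_mass_pos by simp
  show "integrable (gaussian_measure dv) f"
    unfolding eq using assms nn
    by (subst integrable_density) (auto simp: mult_ac intro: integrable_divide)
  show "(\<integral>v. f v \<partial>gaussian_measure dv) = (\<integral>v. f v * gauss v \<partial>dv) / total_mass"
    unfolding eq using assms nn
    by (subst integral_density) (auto simp: mult_ac)
qed

lemma Wick:
  assumes "finite I" "\<And>i. i \<in> I \<Longrightarrow> c i \<in> B"
  shows "integrable (gaussian_measure dv) (\<lambda>v. \<Prod>i\<in>I. v \<bullet> c i)"
    and "(\<integral>v. (\<Prod>i\<in>I. v \<bullet> c i) \<partial>gaussian_measure dv) = real (card (compatible_pairings I c))"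
proof -
  have m: "(\<lambda>v. \<Prod>i\<in>I. v \<bullet> c i) \<in> borel_measurable dv" by measurable
  have "\<bar>\<Prod>i\<in>I. v \<bullet> c i\<bar> \<le> exp (real (card I) * norm v)" for v
  proof -
    have "\<bar>\<Prod>i\<in>I. v \<bullet> c i\<bar> \<le> (\<Prod>i\<in>I. exp (norm v))"
      unfolding abs_prod using assms by (intro prod_mono) (auto intro: abs_coordinate_le_exp)
    then show ?thesis by (simp add: exp_of_nat_mult)
  qed
  note i = integrable_dominated[OF m this]
  show "integrable (gaussian_measure dv) (\<lambda>v. \<Prod>i\<in>I. v \<bullet> c i)"
    by (rule integrable_gaussian_measure(1)[OF m i])
  show "(\<integral>v. (\<Prod>i\<in>I. v \<bullet> c i) \<partial>gaussian_measure dv) = real (card (compatible_pairings I c))"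
    using integrable_gaussian_measure(2)[OF m i] Wick_unnormalized[of I c, OF assms]
      total_mass_pos by simp
qed

end

section \<open>Counting equivariant bijections between permutations\<close>

lemma orbit_eq_of_mem: "permutation \<sigma> \<Longrightarrow> y \<in> orbit \<sigma> x \<Longrightarrow> orbit \<sigma> y = orbit \<sigma> x"
  by (rule orbit_cyclic_eq3[OF cyclic_on_orbit'])

lemma orbit_funpow:
  assumes "permutation \<sigma>"
  shows "(\<sigma> ^^ card (orbit \<sigma> x)) x = x"
    and "orbit \<sigma> x = (\<lambda>i. (\<sigma> ^^ i) x) ` {0..<card (orbit \<sigma> x)}"
    and "inj_on (\<lambda>i. (\<sigma> ^^ i) x) {0..<card (orbit \<sigma> x)}"
proof -
  have x: "x \<in> orbit \<sigma> x" by (rule permutation_self_in_orbit[OF assms])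
  have c: "card (orbit \<sigma> x) = funpow_dist1 \<sigma> x x"
    using orbit_conv_funpow_dist1[OF x] card_image[OF inj_on_funpow_dist1[OF x]] by simp
  show "(\<sigma> ^^ card (orbit \<sigma> x)) x = x"
    unfolding c by (rule funpow_dist1_prop[OF x])
  show "orbit \<sigma> x = (\<lambda>i. (\<sigma> ^^ i) x) ` {0..<card (orbit \<sigma> x)}"
    unfolding c by (rule orbit_conv_funpow_dist1[OF x])
  show "inj_on (\<lambda>i. (\<sigma> ^^ i) x) {0..<card (orbit \<sigma> x)}"
    unfolding c by (rule inj_on_funpow_dist1[OF x])
qed

lemma card_orbit_pos: "permutation \<sigma> \<Longrightarrow> card (orbit \<sigma> x) > 0"
  using finite_orbit[OF permutation_self_in_orbit] orbit_nonempty by (metis card_gt_0_iff)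

lemma funpow_eq_iff_mod:
  assumes "permutation \<sigma>"
  shows "(\<sigma> ^^ i) x = (\<sigma> ^^ j) x \<longleftrightarrow> i mod card (orbit \<sigma> x) = j mod card (orbit \<sigma> x)"
proof -
  let ?k = "card (orbit \<sigma> x)"
  have "(\<sigma> ^^ (i mod ?k)) x = (\<sigma> ^^ i) x" for i
    by (rule funpow_mod_eq[OF orbit_funpow(1)[OF assms]])
  then have "(\<sigma> ^^ i) x = (\<sigma> ^^ j) x \<longleftrightarrow> (\<sigma> ^^ (i mod ?k)) x = (\<sigma> ^^ (j mod ?k)) x"
    by simp
  also have "\<dots> \<longleftrightarrow> i mod ?k = j mod ?k"
    using card_orbit_pos[OF assms] by (intro inj_on_eq_iff[OF orbit_funpow(3)[OF assms]]) auto
  finally show ?thesis .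
qed

definition cycle_type :: "'h set \<Rightarrow> ('h \<Rightarrow> 'h) \<Rightarrow> nat multiset" where
  "cycle_type S \<sigma> = image_mset card (mset_set (orbit \<sigma> ` S))"

text \<open>The sets \<open>S\<close> and \<open>S'\<close> are meant to be closed under permutations of possibly larger sets. This
  allows cycles to be removed from \<open>S\<close> without changing the permutation.\<close>

definition equivariant_bijections ::
    "'h set \<Rightarrow> ('h \<Rightarrow> 'h) \<Rightarrow> 'g set \<Rightarrow> ('g \<Rightarrow> 'g) \<Rightarrow> ('h \<Rightarrow> 'g) set" where
  "equivariant_bijections S \<sigma> S' \<sigma>' =
     {f \<in> S \<rightarrow>\<^sub>E S'. bij_betw f S S' \<and> (\<forall>h\<in>S. f (\<sigma> h) = \<sigma>' (f h))}"

text \<open>The classical order of the centralizer of a permutation of cycle type \<open>m\<close>: permute cycles of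
  equal length \<open>k\<close> and rotate each of them.\<close>

definition centralizer_order :: "nat multiset \<Rightarrow> nat" where
  "centralizer_order m = (\<Prod>k\<in>set_mset m. fact (count m k) * k ^ count m k)"

lemma centralizer_order_add:
  "centralizer_order (add_mset k m) = k * count (add_mset k m) k * centralizer_order m"
proof -
  have *: "centralizer_order m = (\<Prod>j\<in>insert k (set_mset m). fact (count m j) * j ^ count m j)" for m
    unfolding centralizer_order_def by (rule prod.mono_neutral_left) (auto simp: not_in_iff)
  have "centralizer_order (add_mset k m) =
      (fact (Suc (count m k)) * k ^ Suc (count m k)) * (\<Prod>j\<in>set_mset m - {k}. fact (count m j) * j ^ count m j)"
    unfolding *[of "add_mset k m"] by (simp add: prod.insert_remove)
  moreover have "centralizer_order m =
      (fact (count m k) * k ^ count m k) * (\<Prod>j\<in>set_mset m - {k}. fact (count m j) * j ^ count m j)"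
    unfolding *[of m] by (simp add: prod.insert_remove)
  ultimately show ?thesis by (simp add: algebra_simps)
qed

lemma centralizer_order_pos: "0 \<notin># m \<Longrightarrow> centralizer_order m > 0"
  unfolding centralizer_order_def by (intro prod_pos) (auto intro!: Nat.gr0I)

lemma finite_equivariant_bijections:
  "finite S \<Longrightarrow> finite S' \<Longrightarrow> finite (equivariant_bijections S \<sigma> S' \<sigma>')"
  unfolding equivariant_bijections_def
  by (rule finite_subset[of _ "S \<rightarrow>\<^sub>E S'"]) (auto intro: finite_PiE)

lemma orbit_in_closed:
  assumes "\<And>x. x \<in> S \<Longrightarrow> \<sigma> x \<in> S" "x \<in> S"
  shows "orbit \<sigma> x \<subseteq> S"
proof
  fix y assume "y \<in> orbit \<sigma> x"
  then show "y \<in> S" by induct (use assms in auto)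
qed

lemma equivariant_funpow:
  assumes "\<And>x. x \<in> S \<Longrightarrow> \<sigma> x \<in> S" "\<And>x. x \<in> S \<Longrightarrow> f (\<sigma> x) = \<sigma>' (f x)" "x \<in> S"
  shows "(\<sigma> ^^ i) x \<in> S \<and> f ((\<sigma> ^^ i) x) = (\<sigma>' ^^ i) (f x)"
  by (induction i) (use assms in auto)

lemma equivariant_orbit:
  assumes "permutation \<sigma>" "\<And>x. x \<in> S \<Longrightarrow> \<sigma> x \<in> S" "\<And>x. x \<in> S \<Longrightarrow> f (\<sigma> x) = \<sigma>' (f x)" "x \<in> S"
  shows "orbit \<sigma>' (f x) = f ` orbit \<sigma> x"
  using orbit_in_closed[of S \<sigma> x] assms
  by (intro orbit_inverse[symmetric] permutation_self_in_orbit) auto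

lemma closed_Diff_orbit:
  assumes "permutation \<sigma>" "\<And>x. x \<in> S \<Longrightarrow> \<sigma> x \<in> S" "x \<in> S - orbit \<sigma> h"
  shows "\<sigma> x \<in> S - orbit \<sigma> h"
proof -
  have "\<sigma> x \<notin> orbit \<sigma> h"
  proof
    assume "\<sigma> x \<in> orbit \<sigma> h"
    then have "orbit \<sigma> h = orbit \<sigma> x"
      using orbit_eq_of_mem[OF assms(1)] permutation_orbit_step[OF assms(1)] by metis
    then show False using assms(3) permutation_self_in_orbit[OF assms(1)] by auto
  qed
  with assms show ?thesis by auto
qed

lemma cycle_type_remove:
  assumes \<sigma>: "permutation \<sigma>" and S: "finite S" "h \<in> S"
  shows "cycle_type S \<sigma> = add_mset (card (orbit \<sigma> h)) (cycle_type (S - orbit \<sigma> h) \<sigma>)"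
proof -
  have "orbit \<sigma> ` (S - orbit \<sigma> h) = orbit \<sigma> ` S - {orbit \<sigma> h}"
    using orbit_eq_of_mem[OF \<sigma>] permutation_self_in_orbit[OF \<sigma>] by auto
  moreover have "mset_set (orbit \<sigma> ` S) = add_mset (orbit \<sigma> h) (mset_set (orbit \<sigma> ` S - {orbit \<sigma> h}))"
    using S by (intro mset_set.remove) auto
  ultimately show ?thesis by (simp add: cycle_type_def)
qed

lemma card_in_cycles_of_length:
  assumes \<sigma>: "permutation \<sigma>" and S: "finite S" "\<And>x. x \<in> S \<Longrightarrow> \<sigma> x \<in> S"
  shows "card {h \<in> S. card (orbit \<sigma> h) = k} = k * count (cycle_type S \<sigma>) k"
proof -
  let ?W = "{w \<in> orbit \<sigma> ` S. card w = k}"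
  have "{h \<in> S. card (orbit \<sigma> h) = k} = \<Union>?W"
  proof (intro equalityI subsetI)
    fix x assume "x \<in> {h \<in> S. card (orbit \<sigma> h) = k}"
    then show "x \<in> \<Union>?W"
      using permutation_self_in_orbit[OF \<sigma>, of x] by (intro UnionI[of "orbit \<sigma> x"]) auto
  next
    fix x assume "x \<in> \<Union>?W"
    then obtain h where h: "h \<in> S" "card (orbit \<sigma> h) = k" "x \<in> orbit \<sigma> h" by auto
    then show "x \<in> {h \<in> S. card (orbit \<sigma> h) = k}"
      using subsetD[OF orbit_in_closed[of S \<sigma> h, OF S(2) h(1)] h(3)] orbit_eq_of_mem[OF \<sigma> h(3)] by simp
  qed
  also have "card \<dots> = sum card ?W"
  proof (rule card_Union_disjoint)
    show "pairwise disjnt ?W"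
      using orbit_eq_of_mem[OF \<sigma>] by (auto simp: pairwise_def disjnt_def) blast+
  qed (use finite_orbit[OF permutation_self_in_orbit[OF \<sigma>]] in auto)
  also have "\<dots> = k * card ?W" by simp
  also have "card ?W = count (cycle_type S \<sigma>) k"
    using S(1) by (simp add: cycle_type_def count_image_mset_eq_card_vimage)
  finally show ?thesis .
qed

text \<open>An equivariant map is determined on the cycle of \<open>h\<close> by the image of \<open>h\<close>; on the
  complement of this cycle it is an arbitrary equivariant bijection between the complements.\<close>

lemma card_equivariant_extensions:
  assumes \<sigma>: "permutation \<sigma>" "permutation \<sigma>'"
    and closed: "\<And>x. x \<in> S \<Longrightarrow> \<sigma> x \<in> S" "\<And>x. x \<in> S' \<Longrightarrow> \<sigma>' x \<in> S'"
    and h: "h \<in> S" "h' \<in> S'" "card (orbit \<sigma>' h') = card (orbit \<sigma> h)"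
  shows "card {f \<in> equivariant_bijections S \<sigma> S' \<sigma>'. f h = h'} =
    card (equivariant_bijections (S - orbit \<sigma> h) \<sigma> (S' - orbit \<sigma>' h') \<sigma>')"
proof -
  let ?w = "orbit \<sigma> h" and ?w' = "orbit \<sigma>' h'"
  have sub: "?w \<subseteq> S" "?w' \<subseteq> S'" using orbit_in_closed closed h by metis+
  \<comment> \<open>The only equivariant map of the cycle of \<open>h\<close> that sends \<open>h\<close> to \<open>h'\<close>; the
      choice of the exponent is immaterial since both cycles have the same length.\<close>
  define e where "e x = (\<sigma>' ^^ (SOME i. (\<sigma> ^^ i) h = x)) h'" for x
  have e: "e ((\<sigma> ^^ i) h) = (\<sigma>' ^^ i) h'" for i
  proof -
    have "(\<sigma> ^^ (SOME j. (\<sigma> ^^ j) h = (\<sigma> ^^ i) h)) h = (\<sigma> ^^ i) h" by (rule someI) simp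
    then show ?thesis unfolding e_def using funpow_eq_iff_mod \<sigma> h(3) by metis
  qed
  have w: "?w = {(\<sigma> ^^ i) h | i. True}" "?w' = {(\<sigma>' ^^ i) h' | i. True}"
    by (rule orbit_altdef_permutation[OF \<sigma>(1)], rule orbit_altdef_permutation[OF \<sigma>(2)])
  have e_bij: "bij_betw e ?w ?w'"
    unfolding bij_betw_def
  proof
    show "inj_on e ?w"
      unfolding inj_on_def w using funpow_eq_iff_mod[OF \<sigma>(1), of _ h] funpow_eq_iff_mod[OF \<sigma>(2), of _ h'] h(3)
      by (auto simp: e)
    show "e ` ?w = ?w'" unfolding w by (auto simp: e image_iff) (metis e)
  qed
  have e_equi: "\<sigma> x \<in> ?w \<and> e (\<sigma> x) = \<sigma>' (e x)" if x: "x \<in> ?w" for x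
  proof -
    obtain i where i: "x = (\<sigma> ^^ i) h" using x unfolding w(1) by blast
    then have "\<sigma> x = (\<sigma> ^^ Suc i) h" by simp
    then show ?thesis using e[of i] e[of "Suc i"] i orbit.step[OF x] by (simp del: funpow.simps) simp
  qed
  define glue where "glue g = (\<lambda>x\<in>S. if x \<in> ?w then e x else g x)" for g
  have "bij_betw (\<lambda>f. restrict f (S - ?w)) {f \<in> equivariant_bijections S \<sigma> S' \<sigma>'. f h = h'}
      (equivariant_bijections (S - ?w) \<sigma> (S' - ?w') \<sigma>')"
  proof (rule bij_betw_byWitness[where f' = glue])
    show "\<forall>f\<in>{f \<in> equivariant_bijections S \<sigma> S' \<sigma>'. f h = h'}. glue (restrict f (S - ?w)) = f"
    proof
      fix f assume "f \<in> {f \<in> equivariant_bijections S \<sigma> S' \<sigma>'. f h = h'}"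
      then have f: "f \<in> S \<rightarrow>\<^sub>E S'" "\<And>x. x \<in> S \<Longrightarrow> f (\<sigma> x) = \<sigma>' (f x)" "f h = h'"
        by (auto simp: equivariant_bijections_def)
      have "f x = e x" if x: "x \<in> ?w" for x
      proof -
        obtain i where i: "x = (\<sigma> ^^ i) h" using x unfolding w(1) by blast
        have "f ((\<sigma> ^^ i) h) = (\<sigma>' ^^ i) (f h)"
          using equivariant_funpow[of S \<sigma> f \<sigma>' h i] closed(1) f(2) h(1) by blast
        then show ?thesis using f(3) by (simp add: i e)
      qed
      then show "glue (restrict f (S - ?w)) = f"
        using f(1) by (auto simp: glue_def fun_eq_iff PiE_def extensional_def)
    qed
    show "\<forall>g\<in>equivariant_bijections (S - ?w) \<sigma> (S' - ?w') \<sigma>'. restrict (glue g) (S - ?w) = g"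
      by (auto simp: equivariant_bijections_def glue_def fun_eq_iff PiE_def extensional_def)
    show "(\<lambda>f. restrict f (S - ?w)) ` {f \<in> equivariant_bijections S \<sigma> S' \<sigma>'. f h = h'}
        \<subseteq> equivariant_bijections (S - ?w) \<sigma> (S' - ?w') \<sigma>'"
    proof (rule image_subsetI)
      fix f assume "f \<in> {f \<in> equivariant_bijections S \<sigma> S' \<sigma>'. f h = h'}"
      then have f: "bij_betw f S S'" "\<And>x. x \<in> S \<Longrightarrow> f (\<sigma> x) = \<sigma>' (f x)" "f h = h'"
        by (auto simp: equivariant_bijections_def)
      have "f ` ?w = ?w'"
        using equivariant_orbit[OF \<sigma>(1), of S f \<sigma>' h] closed f h by auto
      then have "bij_betw f (S - ?w) (S' - ?w')"
        using f(1) sub by (metis bij_betw_DiffI bij_betw_subset bij_betw_imp_inj_on inj_on_subset bij_betw_def)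
      then have b: "bij_betw (restrict f (S - ?w)) (S - ?w) (S' - ?w')" by simp
      then have "restrict f (S - ?w) \<in> (S - ?w) \<rightarrow>\<^sub>E (S' - ?w')"
        by (auto simp: bij_betw_def PiE_def)
      with b show "restrict f (S - ?w) \<in> equivariant_bijections (S - ?w) \<sigma> (S' - ?w') \<sigma>'"
        using f(2) closed_Diff_orbit[OF \<sigma>(1) closed(1)] by (auto simp: equivariant_bijections_def)
    qed
    show "glue ` equivariant_bijections (S - ?w) \<sigma> (S' - ?w') \<sigma>'
        \<subseteq> {f \<in> equivariant_bijections S \<sigma> S' \<sigma>'. f h = h'}"
    proof (rule image_subsetI)
      fix g assume "g \<in> equivariant_bijections (S - ?w) \<sigma> (S' - ?w') \<sigma>'"
      then have g: "bij_betw g (S - ?w) (S' - ?w')" "\<And>x. x \<in> S - ?w \<Longrightarrow> g (\<sigma> x) = \<sigma>' (g x)"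
        by (auto simp: equivariant_bijections_def)
      have gw: "glue g x = e x" if "x \<in> ?w" for x using that sub by (auto simp: glue_def)
      have gn: "glue g x = g x" if "x \<in> S - ?w" for x using that by (auto simp: glue_def)
      have "bij_betw (glue g) (?w \<union> (S - ?w)) (?w' \<union> (S' - ?w'))"
      proof (rule bij_betw_combine)
        show "bij_betw (glue g) ?w ?w'" using bij_betw_cong[of ?w "glue g" e] gw e_bij by blast
        show "bij_betw (glue g) (S - ?w) (S' - ?w')" using bij_betw_cong[of "S - ?w" "glue g" g] gn g(1) by blast
      qed auto
      moreover have "?w \<union> (S - ?w) = S" "?w' \<union> (S' - ?w') = S'" using sub by auto
      ultimately have b: "bij_betw (glue g) S S'" by simp
      then have "glue g \<in> S \<rightarrow>\<^sub>E S'"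
        unfolding bij_betw_def by (auto simp: glue_def PiE_def)
      moreover have "glue g (\<sigma> x) = \<sigma>' (glue g x)" if x: "x \<in> S" for x
      proof (cases "x \<in> ?w")
        case True
        then show ?thesis using e_equi gw by simp
      next
        case False
        then show ?thesis using x g(2) gn closed_Diff_orbit[OF \<sigma>(1) closed(1), of x h] by simp
      qed
      moreover have "glue g h = h'"
        using gw[OF permutation_self_in_orbit[OF \<sigma>(1)]] e[of 0] by simp
      ultimately show "glue g \<in> {f \<in> equivariant_bijections S \<sigma> S' \<sigma>'. f h = h'}"
        using b by (auto simp: equivariant_bijections_def)
    qed
  qed
  then show ?thesis by (rule bij_betw_same_card)
qed

text \<open>Induction by removing one cycle, of length \<open>k\<close> say, through a point \<open>h\<close>. The image of \<open>h\<close>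
  may be any point on a cycle of length \<open>k\<close>, which gives \<open>k\<close> times the number of \<open>k\<close>-cycles
  choices. This is the factor by which the centralizer order grows.\<close>

theorem card_equivariant_bijections:
  assumes \<sigma>: "permutation \<sigma>" "permutation \<sigma>'"
    and "finite S" "finite S'"
    and "\<And>x. x \<in> S \<Longrightarrow> \<sigma> x \<in> S" "\<And>x. x \<in> S' \<Longrightarrow> \<sigma>' x \<in> S'"
    and "cycle_type S \<sigma> = cycle_type S' \<sigma>'"
  shows "card (equivariant_bijections S \<sigma> S' \<sigma>') = centralizer_order (cycle_type S \<sigma>)"
  using assms(3-)
proof (induction "card S" arbitrary: S S' rule: less_induct)
  case less
  note closed = less.prems(3,4)
  show ?case
  proof (cases "S = {}")
    case True
    then have "cycle_type S' \<sigma>' = {#}" using less.prems(5) by (simp add: cycle_type_def)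
    then have "S' = {}" using less.prems(2) by (simp add: cycle_type_def mset_set_empty_iff)
    with True show ?thesis
      by (simp add: equivariant_bijections_def cycle_type_def centralizer_order_def bij_betw_def)
  next
    case False
    then obtain h where h: "h \<in> S" by auto
    define w where "w = orbit \<sigma> h"
    define m where "m = cycle_type (S - w) \<sigma>"
    define D where "D = {h' \<in> S'. card (orbit \<sigma>' h') = card w}"
    have type: "cycle_type S \<sigma> = add_mset (card w) m"
      unfolding m_def w_def by (rule cycle_type_remove[OF \<sigma>(1) less.prems(1) h])
    have "equivariant_bijections S \<sigma> S' \<sigma>' = (\<Union>h'\<in>D. {f \<in> equivariant_bijections S \<sigma> S' \<sigma>'. f h = h'})"
    proof -
      have "f h \<in> D" if f: "f \<in> equivariant_bijections S \<sigma> S' \<sigma>'" for f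
      proof -
        have f': "bij_betw f S S'" "\<And>x. x \<in> S \<Longrightarrow> f (\<sigma> x) = \<sigma>' (f x)"
          using f by (auto simp: equivariant_bijections_def)
        have "orbit \<sigma>' (f h) = f ` w"
          unfolding w_def by (rule equivariant_orbit[OF \<sigma>(1), of S]) (use closed f' h in auto)
        moreover have "inj_on f w"
          using f'(1) orbit_in_closed[of S \<sigma> h] closed(1) h
          unfolding w_def bij_betw_def by (metis inj_on_subset)
        ultimately show ?thesis using f'(1) h by (auto simp: D_def card_image bij_betw_def)
      qed
      then show ?thesis by blast
    qed
    also have "card \<dots> = (\<Sum>h'\<in>D. card {f \<in> equivariant_bijections S \<sigma> S' \<sigma>'. f h = h'})"
      using finite_equivariant_bijections[OF less.prems(1,2), of \<sigma> \<sigma>'] less.prems(2)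
      by (intro card_UN_disjoint) (auto simp: D_def)
    also have "\<dots> = (\<Sum>h'\<in>D. centralizer_order m)"
    proof (intro sum.cong refl)
      fix h' assume h': "h' \<in> D"
      have "card {f \<in> equivariant_bijections S \<sigma> S' \<sigma>'. f h = h'} =
          card (equivariant_bijections (S - w) \<sigma> (S' - orbit \<sigma>' h') \<sigma>')"
        unfolding w_def using h' closed h
        by (intro card_equivariant_extensions[OF \<sigma>]) (auto simp: D_def w_def)
      also have "\<dots> = centralizer_order m"
        unfolding m_def
      proof (rule less.hyps)
        show "card (S - w) < card S"
          using h permutation_self_in_orbit[OF \<sigma>(1), of h] less.prems(1)
          by (intro psubset_card_mono) (auto simp: w_def)
        show "\<sigma> x \<in> S - w" if "x \<in> S - w" for x
          using closed_Diff_orbit[of \<sigma> S x h] \<sigma>(1) closed(1) that unfolding w_def by blast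
        show "\<sigma>' x \<in> S' - orbit \<sigma>' h'" if "x \<in> S' - orbit \<sigma>' h'" for x
          using closed_Diff_orbit[of \<sigma>' S' x h'] \<sigma>(2) closed(2) that by blast
        show "cycle_type (S - w) \<sigma> = cycle_type (S' - orbit \<sigma>' h') \<sigma>'"
          using cycle_type_remove[OF \<sigma>(2) less.prems(2), of h'] h' type less.prems(5)
          by (simp add: m_def D_def)
      qed (use less.prems in auto)
      finally show "card {f \<in> equivariant_bijections S \<sigma> S' \<sigma>'. f h = h'} = centralizer_order m" .
    qed
    also have "\<dots> = card D * centralizer_order m" by simp
    also have "card D = card w * count (cycle_type S \<sigma>) (card w)"
      unfolding D_def less.prems(5) by (rule card_in_cycles_of_length[OF \<sigma>(2) less.prems(2) closed(2)])
    finally show ?thesis unfolding type centralizer_order_add .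
  qed
qed

lemma cyclic_shift:
  fixes k N :: nat
  assumes "k > 0"
  defines "\<tau> \<equiv> (\<lambda>x. if x \<in> {N..<N + k} then (if Suc x = N + k then N else Suc x) else x)"
  shows "\<tau> permutes {N..<N + k}" and "x \<in> {N..<N + k} \<Longrightarrow> orbit \<tau> x = {N..<N + k}"
proof -
  show perm: "\<tau> permutes {N..<N + k}"
  proof (rule bij_imp_permutes)
    show "bij_betw \<tau> {N..<N + k} {N..<N + k}"
      by (rule bij_betw_byWitness[where f' = "\<lambda>x. if x = N then N + k - 1 else x - 1"])
         (use assms in \<open>auto simp: \<tau>_def\<close>)
  qed (auto simp: \<tau>_def)
  then have "permutation \<tau>" by (auto simp: permutation_permutes)
  have shift: "(\<tau> ^^ i) N = N + i" if "i < k" for i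
    using that by (induction i) (auto simp: \<tau>_def)
  have "(\<tau> ^^ k) N = \<tau> ((\<tau> ^^ (k - 1)) N)"
    using \<open>k > 0\<close> by (cases k) auto
  also have "\<dots> = N" using \<open>k > 0\<close> by (simp add: shift) (simp add: \<tau>_def)
  finally have "orbit \<tau> N = {(\<tau> ^^ i) N | i. i < k}"
    by (rule orbit_altdef_bounded) fact
  also have "\<dots> = {N + i | i. i < k}" using shift by metis
  also have "\<dots> = {N..<N + k}" by (auto simp: nat_le_iff_add)
  finally have "orbit \<tau> N = {N..<N + k}" .
  then show "orbit \<tau> x = {N..<N + k}" if "x \<in> {N..<N + k}"
    using orbit_eq_of_mem[OF \<open>permutation \<tau>\<close>] that by metis
qed

text \<open>The cycles are placed on consecutive intervals of natural numbers. Length \<open>0\<close> must be excluded,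
  because cycles are not empty.\<close>

lemma exists_permutation_of_cycle_type:
  assumes "0 \<notin># m"
  obtains H :: "nat set" and \<sigma> where "finite H" "\<sigma> permutes H" "cycle_type H \<sigma> = m"
proof -
  have "\<exists>(H::nat set) \<sigma>. finite H \<and> \<sigma> permutes H \<and> cycle_type H \<sigma> = m"
    using assms
  proof (induction m)
    case empty
    show ?case by (intro exI[of _ "{}"] exI[of _ id]) (auto simp: cycle_type_def permutes_id)
  next
    case (add k m)
    then obtain H :: "nat set" and \<sigma> where H: "finite H" "\<sigma> permutes H" "cycle_type H \<sigma> = m" by auto
    have k: "k > 0" using add.prems by (auto intro: Nat.gr0I)
    define N where "N = Suc (Max (insert 0 H))"
    have N: "x < N" if "x \<in> H" for x
      using that H(1) by (auto simp: N_def less_Suc_eq_le)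
    define K where "K = {N..<N + k}"
    obtain \<tau> where \<tau>: "\<tau> permutes K" "\<And>x. x \<in> K \<Longrightarrow> orbit \<tau> x = K"
      by (rule that[OF cyclic_shift(1)[OF k, of N, folded K_def] cyclic_shift(2)[OF k, of _ N, folded K_def]])
    have disj: "H \<inter> K = {}" using N by (force simp: K_def)
    have K: "finite K" "card K = k" "K \<noteq> {}" using k by (auto simp: K_def)
    define \<rho> where "\<rho> = \<sigma> \<circ> \<tau>"
    have \<rho>H: "\<rho> x = \<sigma> x" "\<sigma> x \<in> H" if "x \<in> H" for x
      using that disj \<tau>(1) H(2) by (auto simp: \<rho>_def permutes_in_image) (metis disjoint_iff permutes_not_in)
    have \<rho>K: "\<rho> x = \<tau> x" "\<tau> x \<in> K" if "x \<in> K" for x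
      using that disj \<tau>(1) H(2) by (auto simp: \<rho>_def permutes_in_image) (metis disjoint_iff permutes_in_image permutes_not_in)
    have oH: "orbit \<rho> x = orbit \<sigma> x" if "x \<in> H" for x
      using that \<rho>H by (intro orbit_cong0[of x H]) auto
    have oK: "orbit \<rho> x = K" if "x \<in> K" for x
      using that \<rho>K \<tau>(2) orbit_cong0[of x K \<rho> \<tau>] by auto
    have "\<rho> permutes H \<union> K"
      unfolding \<rho>_def by (rule permutes_compose; rule permutes_subset[OF \<tau>(1)] permutes_subset[OF H(2)]) auto
    moreover have "cycle_type (H \<union> K) \<rho> = add_mset k m"
    proof -
      have "orbit \<rho> ` (H \<union> K) = insert K (orbit \<sigma> ` H)"
        using oH oK K(3) by (auto simp: image_Un image_iff)
      moreover have "K \<notin> orbit \<sigma> ` H"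
        using disj K(3) permutes_orbit_subset[OF H(2)] by blast
      ultimately show ?thesis using H K by (simp add: cycle_type_def)
    qed
    ultimately show ?case using H(1) K(1) by (intro exI[of _ "H \<union> K"] exI[of _ \<rho>]) auto
  qed
  then show ?thesis using that by blast
qed

section \<open>Coefficients of the exponential of a linear power series\<close>

lemma coeff_one: "mfps_coeff 1 m = (if m = {#} then 1 else 0)"
  by (simp add: one_mfps_def mfps_const_def)

lemma coeff_sum: "mfps_coeff (sum f A) m = (\<Sum>a\<in>A. mfps_coeff (f a) m)"
  by (induction A rule: infinite_finite_induct) (auto simp: zero_mfps_def plus_mfps_def)

definition monomial :: "nat multiset \<Rightarrow> 'c::zero \<Rightarrow> 'c mfps" where
  "monomial m c = MFPS (\<lambda>m'. if m' = m then c else 0)"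

lemma coeff_monomial_mult:
  "mfps_coeff (monomial a c * g) m = (if a \<subseteq># m then c * mfps_coeff g (m - a) else 0)"
  for g :: "'c::comm_ring_1 mfps"
proof -
  have "mfps_coeff (monomial a c * g) m =
      (\<Sum>p\<in>splits m. if p = (a, m - a) then c * mfps_coeff g (m - a) else 0)"
    unfolding times_mfps_def mfps.sel
    by (rule sum.cong) (auto simp: splits_def monomial_def split: if_split_asm)
  moreover have "(a, m - a) \<in> splits m \<longleftrightarrow> a \<subseteq># m"
    by (auto simp: splits_def) (metis mset_subset_eq_add_left)
  ultimately show ?thesis by simp
qed

lemma monomial_mult: "monomial a c * monomial b d = monomial (a + b) (c * d :: 'c::comm_ring_1)"
proof (rule mfps_eqI)
  fix m
  show "mfps_coeff (monomial a c * monomial b d) m = mfps_coeff (monomial (a + b) (c * d)) m"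
    unfolding coeff_monomial_mult by (auto simp: monomial_def subset_mset.diff_add)
qed

lemma mfps_const_eq_monomial: "mfps_const c = monomial {#} c"
  and mfps_var_eq_monomial: "mfps_var k = monomial {#k#} (1 :: 'c::comm_ring_1)"
  and one_eq_monomial: "(1 :: 'c::comm_ring_1 mfps) = monomial {#} 1"
  by (auto simp: mfps_const_def mfps_var_def monomial_def one_mfps_def)

lemma coeff_const_mult: "mfps_coeff (mfps_const c * g) m = c * mfps_coeff g m"
  for g :: "'c::comm_ring_1 mfps"
  by (simp add: mfps_const_eq_monomial coeff_monomial_mult)

lemma var_const_eq_monomial: "mfps_var k * mfps_const c = monomial {#k#} (c :: 'c::comm_ring_1)"
  by (simp add: mfps_const_eq_monomial mfps_var_eq_monomial monomial_mult)

lemma prod_monomial: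
  "finite S \<Longrightarrow> (\<Prod>v\<in>S. monomial {#f v#} (g v :: 'c::comm_ring_1)) =
     monomial (image_mset f (mset_set S)) (\<Prod>v\<in>S. g v)"
  by (induction S rule: finite_induct) (simp_all add: monomial_mult one_eq_monomial)

lemma coeff_linear_mult:
  fixes f g :: "'c::comm_ring_1 mfps"
  assumes linear: "\<And>m. size m \<noteq> 1 \<Longrightarrow> mfps_coeff f m = 0"
  shows "mfps_coeff (f * g) m = (\<Sum>k\<in>set_mset m. mfps_coeff f {#k#} * mfps_coeff g (m - {#k#}))"
proof -
  let ?s = "\<lambda>k. ({#k#}, m - {#k#})"
  have "mfps_coeff (f * g) m = (\<Sum>(a, b)\<in>splits m. mfps_coeff f a * mfps_coeff g b)"
    by (simp add: times_mfps_def)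
  also have "\<dots> = (\<Sum>(a, b)\<in>?s ` set_mset m. mfps_coeff f a * mfps_coeff g b)"
  proof (rule sum.mono_neutral_right)
    show "?s ` set_mset m \<subseteq> splits m" by (auto simp: splits_def)
    show "\<forall>p\<in>splits m - ?s ` set_mset m. (case p of (a, b) \<Rightarrow> mfps_coeff f a * mfps_coeff g b) = 0"
    proof
      fix p assume p: "p \<in> splits m - ?s ` set_mset m"
      obtain a b where ab: "p = (a, b)" by fastforce
      have "size a \<noteq> 1"
      proof
        assume "size a = 1"
        then obtain k where "a = {#k#}" using size_1_singleton_mset by blast
        then have "k \<in># m" "b = m - {#k#}" using p ab by (auto simp: splits_def)
        then show False using p ab \<open>a = {#k#}\<close> by auto
      qed
      then show "(case p of (a, b) \<Rightarrow> mfps_coeff f a * mfps_coeff g b) = 0" using linear ab by simp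
    qed
  qed simp
  also have "\<dots> = (\<Sum>k\<in>set_mset m. mfps_coeff f {#k#} * mfps_coeff g (m - {#k#}))"
    by (subst sum.reindex) (auto simp: inj_on_def)
  finally show ?thesis .
qed

text \<open>The coefficients \<open>t k / k\<close> are scaled such that the exponential series directly produces the
  centralizer order in the denominator. Index \<open>0\<close> is covered as well: its
  coefficient \<open>t 0 / 0\<close> is zero, and a multiset containing \<open>0\<close> has centralizer order zero, so
  that the quotient is zero too.\<close>

lemma coeff_linear_power:
  fixes f :: "'c::field_char_0 mfps"
  assumes linear: "\<And>m. size m \<noteq> 1 \<Longrightarrow> mfps_coeff f m = 0"
    and coeff: "\<And>k. mfps_coeff f {#k#} = t k / of_nat k"
  shows "mfps_coeff (f ^ n) m =
    (if size m = n then fact n * (\<Prod>k\<in>#m. t k) / of_nat (centralizer_order m) else 0)"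
proof (induction n arbitrary: m)
  case 0
  then show ?case by (auto simp: coeff_one centralizer_order_def)
next
  case (Suc n)
  let ?c = "\<lambda>m. (\<Prod>k\<in>#m. t k) / of_nat (centralizer_order m)"
  have "mfps_coeff (f ^ Suc n) m =
      (\<Sum>k\<in>set_mset m. t k / of_nat k * mfps_coeff (f ^ n) (m - {#k#}))"
    by (simp add: coeff_linear_mult[OF linear] coeff)
  also have "\<dots> = (\<Sum>k\<in>set_mset m. of_nat (count m k) * (if size m = Suc n then fact n * ?c m else 0))"
  proof (intro sum.cong refl)
    fix k assume k: "k \<in># m"
    then have m: "m = add_mset k (m - {#k#})" by simp
    have "of_nat (centralizer_order m) =
        (of_nat k * of_nat (count m k) * of_nat (centralizer_order (m - {#k#})) :: 'c)"
      using centralizer_order_add[of k "m - {#k#}"] m by (metis of_nat_mult)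
    moreover have "(\<Prod>k\<in>#m. t k) = t k * (\<Prod>k\<in>#m - {#k#}. t k)"
      by (subst m) simp
    moreover obtain q :: 'c where "of_nat (count m k) = q" "q \<noteq> 0"
      using k by (metis count_eq_zero_iff of_nat_eq_0_iff)
    moreover have "size m = Suc n \<longleftrightarrow> size (m - {#k#}) = n" using k size_Suc_Diff1[OF k] by auto
    ultimately show "t k / of_nat k * mfps_coeff (f ^ n) (m - {#k#}) =
        of_nat (count m k) * (if size m = Suc n then fact n * ?c m else 0)"
      by (simp add: Suc.IH mult_ac)
  qed
  also have "\<dots> = of_nat (size m) * (if size m = Suc n then fact n * ?c m else 0)"
    by (simp only: size_multiset_overloaded_eq of_nat_sum sum_distrib_right)
  also have "\<dots> = (if size m = Suc n then fact (Suc n) * (\<Prod>k\<in>#m. t k) / of_nat (centralizer_order m) else 0)"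
    by (auto simp: algebra_simps)
  finally show ?case .
qed

lemma coeff_exp_linear:
  fixes f :: "'c::field_char_0 mfps"
  assumes "\<And>m. size m \<noteq> 1 \<Longrightarrow> mfps_coeff f m = 0"
    and "\<And>k. mfps_coeff f {#k#} = t k / of_nat k"
  shows "mfps_coeff (mfps_exp f) m = (\<Prod>k\<in>#m. t k) / of_nat (centralizer_order m)"
proof -
  let ?a = "\<lambda>n. mfps_coeff (mfps_const (1 / fact n) * f ^ n) m"
  have a: "?a n = (if n = size m then (\<Prod>k\<in>#m. t k) / of_nat (centralizer_order m) else 0)" for n
    by (simp add: coeff_const_mult coeff_linear_power[OF assms])
  have "mfps_coeff (mfps_exp f) m = (\<Sum>n\<in>{n. ?a n \<noteq> 0}. ?a n)"
    by (simp add: mfps_exp_def formal_sum_def)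
  also have "\<dots> = (\<Sum>n\<in>{size m}. ?a n)"
    by (rule sum.mono_neutral_left) (auto simp: a)
  also have "\<dots> = (\<Prod>k\<in>#m. t k) / of_nat (centralizer_order m)" by (simp add: a)
  finally show ?thesis .
qed

lemma coeff_exp_potential:
  "mfps_coeff (mfps_exp (potential T v)) m =
     (\<Prod>k\<in>#m. T k (replicate k (of_real_vec v))) / of_nat (centralizer_order m)"
proof (rule coeff_exp_linear)
  let ?y = "\<lambda>k. T k (replicate k (of_real_vec v)) / of_nat k"
  have coeff: "mfps_coeff (potential T v) m = (\<Sum>k\<in>{k \<in> {1..}. m = {#k#} \<and> ?y k \<noteq> 0}. ?y k)" for m
  proof -
    have "{k \<in> {1..}. mfps_coeff (mfps_var k * mfps_const (?y k)) m \<noteq> 0} = {k \<in> {1..}. m = {#k#} \<and> ?y k \<noteq> 0}"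
      by (auto simp: var_const_eq_monomial monomial_def)
    then show ?thesis
      unfolding potential_def formal_sum_def
      by (simp add: var_const_eq_monomial monomial_def cong: sum.cong_simp)
  qed
  show "mfps_coeff (potential T v) m = 0" if "size m \<noteq> 1" for m
    unfolding coeff using that by (intro sum.neutral) auto
  show "mfps_coeff (potential T v) {#k#} = ?y k" for k
  proof (cases "k \<ge> 1 \<and> ?y k \<noteq> 0")
    case True
    then have "{j \<in> {1..}. {#k#} = {#j#} \<and> ?y j \<noteq> 0} = {k}" by auto
    then show ?thesis unfolding coeff by simp
  next
    case False
    then have none: "{j \<in> {1..}. {#k#} = {#j#} \<and> ?y j \<noteq> 0} = {}" by auto
    show ?thesis unfolding coeff none using False by (cases k) auto
  qed
qed

section \<open>Vertices, half-edge colourings and the graphical calculus\<close>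

text \<open>A collection of vertices whose half-edges have not yet been joined. Ribbon graphs alone would
  not be general enough: a collection with an odd number of half-edges cannot be completed to a
  ribbon graph, but its Gaussian integral still has to be computed (it is zero).\<close>

definition is_vertex_system :: "'h ribbon_graph \<Rightarrow> bool" where
  "is_vertex_system \<Gamma> \<longleftrightarrow> finite (half_edges \<Gamma>) \<and> vperm \<Gamma> permutes half_edges \<Gamma>"

lemma vertex_systemD:
  assumes "is_vertex_system \<Gamma>"
  shows "finite (half_edges \<Gamma>)" "vperm \<Gamma> permutes half_edges \<Gamma>" "permutation (vperm \<Gamma>)"
    and "\<And>h. h \<in> half_edges \<Gamma> \<Longrightarrow> vperm \<Gamma> h \<in> half_edges \<Gamma>"
  using assms by (auto simp: is_vertex_system_def permutation_permutes permutes_in_image)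

lemma ribbon_vertex_system: "is_ribbon_graph \<Gamma> \<Longrightarrow> is_vertex_system \<Gamma>"
  by (simp add: is_ribbon_graph_def is_vertex_system_def)

lemma ribbon_graphD:
  assumes "is_ribbon_graph \<Gamma>"
  shows "finite (half_edges \<Gamma>)" "vperm \<Gamma> permutes half_edges \<Gamma>" "permutation (vperm \<Gamma>)"
    and "\<And>h. h \<in> half_edges \<Gamma> \<Longrightarrow> vperm \<Gamma> h \<in> half_edges \<Gamma>"
    and "eperm \<Gamma> \<in> pairings (half_edges \<Gamma>)"
    and "\<And>h. h \<in> half_edges \<Gamma> \<Longrightarrow> eperm \<Gamma> h \<in> half_edges \<Gamma>"
    and "\<And>h. h \<in> half_edges \<Gamma> \<Longrightarrow> eperm \<Gamma> (eperm \<Gamma> h) = h"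
  using assms by (auto simp: is_ribbon_graph_def permutation_permutes pairings_def permutes_in_image)

lemma vertex_facts:
  assumes \<Gamma>: "is_vertex_system \<Gamma>" and w: "w \<in> vertices \<Gamma>"
  shows "w \<subseteq> half_edges \<Gamma>"
    and "(SOME h. h \<in> w) \<in> w"
    and "s \<in> w \<Longrightarrow> orbit (vperm \<Gamma>) s = w"
    and "distinct (cyclic_list \<Gamma> w)" "set (cyclic_list \<Gamma> w) = w" "length (cyclic_list \<Gamma> w) = card w"
    and "card w \<ge> 1"
proof -
  note \<sigma> = vertex_systemD(3)[OF \<Gamma>]
  obtain h where h: "h \<in> half_edges \<Gamma>" "w = orbit (vperm \<Gamma>) h"
    using w by (auto simp: vertices_def)
  show "w \<subseteq> half_edges \<Gamma>"
    unfolding h(2) by (rule permutes_orbit_subset[OF vertex_systemD(2)[OF \<Gamma>] h(1)])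
  show s: "(SOME h. h \<in> w) \<in> w"
    using permutation_self_in_orbit[OF \<sigma>, of h] unfolding h(2) by (rule someI)
  show orb: "orbit (vperm \<Gamma>) s = w" if "s \<in> w" for s
    using orbit_eq_of_mem[OF \<sigma>, of s h] that h(2) by simp
  show "distinct (cyclic_list \<Gamma> w)" "set (cyclic_list \<Gamma> w) = w"
    using orbit_funpow(2,3)[OF \<sigma>, of "SOME h. h \<in> w"] orb[OF s]
    by (simp_all add: cyclic_list_def distinct_map)
  show "length (cyclic_list \<Gamma> w) = card w" by (simp add: cyclic_list_def)
  show "card w \<ge> 1" using card_orbit_pos[OF \<sigma>, of h] h(2) by simp
qed

lemma finite_vertices: "is_vertex_system \<Gamma> \<Longrightarrow> finite (vertices \<Gamma>)"
  by (simp add: vertices_def vertex_systemD)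

lemma vertices_disjoint:
  assumes "is_vertex_system \<Gamma>" "w \<in> vertices \<Gamma>" "w' \<in> vertices \<Gamma>" "h \<in> w" "h \<in> w'"
  shows "w = w'"
  using vertex_facts(3)[OF assms(1,2,4)] vertex_facts(3)[OF assms(1,3,5)] by simp

text \<open>The vectors at the half-edges are arbitrary here. Constant assignments give the monomials
  that are integrated, and assignments of basis vectors give the summands of the graphical calculus.\<close>

definition vertex_product ::
    "(nat \<Rightarrow> 'a::real_vector complexification list \<Rightarrow> 'c::comm_ring_1) \<Rightarrow> 'h ribbon_graph \<Rightarrow> ('h \<Rightarrow> 'a) \<Rightarrow> 'c" where
  "vertex_product T \<Gamma> u =
     (\<Prod>w\<in>vertices \<Gamma>. T (card w) (map (\<lambda>h. of_real_vec (u h)) (cyclic_list \<Gamma> w)))"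

lemma vertex_product_cong:
  assumes "is_vertex_system \<Gamma>" "\<And>h. h \<in> half_edges \<Gamma> \<Longrightarrow> u h = u' h"
  shows "vertex_product T \<Gamma> u = vertex_product T \<Gamma> u'"
  unfolding vertex_product_def
proof (intro prod.cong refl arg_cong[where f = "T _"] map_cong)
  fix w h assume "w \<in> vertices \<Gamma>" "h \<in> set (cyclic_list \<Gamma> w)"
  then have "h \<in> half_edges \<Gamma>" using vertex_facts(1,5)[OF assms(1)] by blast
  then show "of_real_vec (u h) = of_real_vec (u' h)" using assms(2) by simp
qed

text \<open>Colourings of half-edges that agree on the two halves of every edge. They correspond to
  colourings of edges but, unlike those, can be compared for different edge structures on the
  same half-edges.\<close>

definition edge_colourings :: "'a set \<Rightarrow> 'h ribbon_graph \<Rightarrow> ('h \<Rightarrow> 'a) set" where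
  "edge_colourings B \<Gamma> =
     {c \<in> half_edges \<Gamma> \<rightarrow>\<^sub>E B. \<forall>h\<in>half_edges \<Gamma>. c (eperm \<Gamma> h) = c h}"

lemma graph_value_eq_sum_edge_colourings:
  assumes \<Gamma>: "is_ribbon_graph \<Gamma>"
  shows "graph_value B T \<Gamma> = (\<Sum>c\<in>edge_colourings B \<Gamma>. vertex_product T \<Gamma> c)"
proof -
  let ?H = "half_edges \<Gamma>" and ?e = "edge_containing \<Gamma>"
  have e_eq: "?e (eperm \<Gamma> h) = ?e h" if "h \<in> ?H" for h
    using ribbon_graphD(7)[OF \<Gamma> that] by (auto simp: edge_containing_def)
  have some: "(SOME h. h \<in> ?e h0) \<in> {h0, eperm \<Gamma> h0}" for h0
    using someI[of "\<lambda>h. h \<in> ?e h0" h0] by (simp add: edge_containing_def)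
  have some_col: "c (SOME h. h \<in> ?e h0) = c h0" if "c \<in> edge_colourings B \<Gamma>" "h0 \<in> ?H" for c h0
    using some[of h0] that by (auto simp: edge_colourings_def)
  show ?thesis
    unfolding graph_value_def
  proof (rule sum.reindex_bij_witness[where j = "\<lambda>c. \<lambda>h\<in>?H. c (?e h)" and i = "\<lambda>c. \<lambda>e\<in>edges \<Gamma>. c (SOME h. h \<in> e)"])
    fix c assume c: "c \<in> edges \<Gamma> \<rightarrow>\<^sub>E B"
    show "(\<lambda>h\<in>?H. c (?e h)) \<in> edge_colourings B \<Gamma>"
      using c e_eq ribbon_graphD(6)[OF \<Gamma>] by (auto simp: edge_colourings_def edges_def PiE_def Pi_def)
    show "(\<lambda>e\<in>edges \<Gamma>. (\<lambda>h\<in>?H. c (?e h)) (SOME h. h \<in> e)) = c"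
    proof
      fix e
      show "(\<lambda>e\<in>edges \<Gamma>. (\<lambda>h\<in>?H. c (?e h)) (SOME h. h \<in> e)) e = c e"
      proof (cases "e \<in> edges \<Gamma>")
        case True
        then obtain h0 where h0: "h0 \<in> ?H" "e = ?e h0" by (auto simp: edges_def)
        define x where "x = (SOME h. h \<in> e)"
        have "x = h0 \<or> x = eperm \<Gamma> h0" using some[of h0] unfolding x_def h0(2) by blast
        then have "?e x = e" "x \<in> ?H"
          using e_eq[OF h0(1)] ribbon_graphD(6)[OF \<Gamma> h0(1)] h0 by auto
        then show ?thesis using True by (simp add: x_def[symmetric])
      next
        case False
        then show ?thesis using c by (auto simp: PiE_def extensional_def)
      qed
    qed
    have "vertex_product T \<Gamma> (\<lambda>h\<in>?H. c (?e h)) = vertex_product T \<Gamma> (\<lambda>h. c (?e h))"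
      by (rule vertex_product_cong[OF ribbon_vertex_system[OF \<Gamma>]]) simp
    then show "vertex_product T \<Gamma> (\<lambda>h\<in>?H. c (?e h)) =
        (\<Prod>v\<in>vertices \<Gamma>. T (card v) (map (\<lambda>h. of_real_vec (c (?e h))) (cyclic_list \<Gamma> v)))"
      by (simp add: vertex_product_def)
  next
    fix c assume c: "c \<in> edge_colourings B \<Gamma>"
    show "(\<lambda>e\<in>edges \<Gamma>. c (SOME h. h \<in> e)) \<in> edges \<Gamma> \<rightarrow>\<^sub>E B"
      using c some_col[OF c] by (auto simp: edge_colourings_def edges_def PiE_def Pi_def)
    show "(\<lambda>h\<in>?H. (\<lambda>e\<in>edges \<Gamma>. c (SOME h. h \<in> e)) (?e h)) = c"
      using c some_col[OF c] by (auto simp: edge_colourings_def edges_def PiE_def extensional_def fun_eq_iff)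
  qed
qed

text \<open>Every summand of \<^const>\<open>Z_x\<close> is the same monomial, recording the valences of the vertices, times
  a numerical product. Its numerical part is the graphical calculus of \<open>T\<close> itself.\<close>

lemma coeff_Z_x:
  assumes "is_ribbon_graph \<Gamma>"
  shows "mfps_coeff (Z_x B T \<Gamma>) m =
    (if m = cycle_type (half_edges \<Gamma>) (vperm \<Gamma>) then graph_value B T \<Gamma> else 0)"
  unfolding Z_x_def graph_value_def var_const_eq_monomial coeff_sum
  by (simp add: prod_monomial finite_vertices[OF ribbon_vertex_system[OF assms]])
     (simp add: monomial_def cycle_type_def vertices_def)

lemma coeff_weight:
  assumes "is_ribbon_graph \<Gamma>"
  shows "mfps_coeff (weight B T \<Gamma>) m =
    (if m = cycle_type (half_edges \<Gamma>) (vperm \<Gamma>) then graph_value B T \<Gamma> / of_nat (card (Aut \<Gamma>)) else 0)"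
  by (simp add: weight_def coeff_const_mult coeff_Z_x[OF assms])

section \<open>Gaussian integral of a product of vertex tensors\<close>

lemma sum_PiE_insert:
  assumes "finite S" "a \<notin> S"
  shows "(\<Sum>c\<in>insert a S \<rightarrow>\<^sub>E B. f c) = (\<Sum>b\<in>B. \<Sum>c\<in>S \<rightarrow>\<^sub>E B. f (c(a := b)))"
proof -
  have "(\<Sum>c\<in>insert a S \<rightarrow>\<^sub>E B. f c) = (\<Sum>(b, c)\<in>B \<times> (S \<rightarrow>\<^sub>E B). f (c(a := b)))"
    unfolding PiE_insert_eq
    by (subst sum.reindex[OF inj_combinator[OF assms(2)]]) (simp add: case_prod_unfold)
  then show ?thesis by (simp add: sum.cartesian_product)
qed

definition real_linear_in :: "'h \<Rightarrow> (('h \<Rightarrow> 'a::real_vector) \<Rightarrow> complex) \<Rightarrow> bool" where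
  "real_linear_in h F \<longleftrightarrow>
     (\<forall>u y z. F (u(h := y + z)) = F (u(h := y)) + F (u(h := z))) \<and>
     (\<forall>u y r. F (u(h := r *\<^sub>R y)) = of_real r * F (u(h := y)))"

lemma real_linear_in_sum:
  assumes "real_linear_in h F" "finite A"
  shows "F (u(h := \<Sum>b\<in>A. r b *\<^sub>R y b)) = (\<Sum>b\<in>A. of_real (r b) * F (u(h := y b)))"
  using assms(2)
proof induction
  case empty
  have "F (u(h := 0 *\<^sub>R 0)) = of_real 0 * F (u(h := 0))"
    using assms(1) unfolding real_linear_in_def by blast
  then show ?case by (simp add: fun_upd_def)
next
  case (insert a A)
  have "F (u(h := r a *\<^sub>R y a + (\<Sum>b\<in>A. r b *\<^sub>R y b))) =
      of_real (r a) * F (u(h := y a)) + F (u(h := \<Sum>b\<in>A. r b *\<^sub>R y b))"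
    using assms(1) unfolding real_linear_in_def by metis
  then show ?case using insert by (simp add: fun_upd_def)
qed

text \<open>Expand the arguments in \<open>S\<close> one after the other in the orthonormal basis.\<close>

lemma (in invariant_measure_space) multilinear_expansion:
  assumes "finite S" "\<And>h. h \<in> S \<Longrightarrow> real_linear_in h F"
  shows "F u = (\<Sum>c\<in>S \<rightarrow>\<^sub>E B. of_real (\<Prod>h\<in>S. u h \<bullet> c h) * F (\<lambda>h. if h \<in> S then c h else u h))"
  using assms
proof (induction arbitrary: u)
  case empty
  then show ?case by simp
next
  case (insert a S)
  have "F u = (\<Sum>c\<in>S \<rightarrow>\<^sub>E B. of_real (\<Prod>h\<in>S. u h \<bullet> c h) * F (\<lambda>h. if h \<in> S then c h else u h))"
    by (rule insert.IH) (use insert.prems in auto)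
  also have "\<dots> = (\<Sum>c\<in>S \<rightarrow>\<^sub>E B. \<Sum>b\<in>B. of_real (\<Prod>h\<in>insert a S. u h \<bullet> (c(a := b)) h) *
      F (\<lambda>h. if h \<in> insert a S then (c(a := b)) h else u h))"
  proof (intro sum.cong refl)
    fix c
    let ?u = "\<lambda>h. if h \<in> S then c h else u h"
    have "F ?u = F (?u(a := \<Sum>b\<in>B. (u a \<bullet> b) *\<^sub>R b))"
      using insert.hyps by (intro arg_cong[where f = F]) (auto simp: basis_expansion)
    also have "\<dots> = (\<Sum>b\<in>B. of_real (u a \<bullet> b) * F (?u(a := b)))"
      by (rule real_linear_in_sum) (use insert.prems finite_basis in auto)
    also have "\<dots> = (\<Sum>b\<in>B. of_real (u a \<bullet> b) * F (\<lambda>h. if h \<in> insert a S then (c(a := b)) h else u h))"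
      using insert.hyps by (intro sum.cong refl arg_cong2[where f = "(*)"] arg_cong[where f = F]) auto
    finally have "of_real (\<Prod>h\<in>S. u h \<bullet> c h) * F ?u =
        (\<Sum>b\<in>B. of_real (\<Prod>h\<in>S. u h \<bullet> c h) * (of_real (u a \<bullet> b) * F (\<lambda>h. if h \<in> insert a S then (c(a := b)) h else u h)))"
      by (simp add: sum_distrib_left)
    moreover have "(\<Prod>h\<in>insert a S. u h \<bullet> (c(a := b)) h) = (u a \<bullet> b) * (\<Prod>h\<in>S. u h \<bullet> c h)" for b
    proof -
      have "(\<Prod>h\<in>S. u h \<bullet> (c(a := b)) h) = (\<Prod>h\<in>S. u h \<bullet> c h)"
        using insert.hyps by (intro prod.cong) auto
      then show ?thesis using insert.hyps by simp
    qed
    ultimately show "of_real (\<Prod>h\<in>S. u h \<bullet> c h) * F ?u =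
        (\<Sum>b\<in>B. of_real (\<Prod>h\<in>insert a S. u h \<bullet> (c(a := b)) h) *
          F (\<lambda>h. if h \<in> insert a S then (c(a := b)) h else u h))"
      by (simp add: mult_ac)
  qed
  also have "\<dots> = (\<Sum>c\<in>insert a S \<rightarrow>\<^sub>E B. of_real (\<Prod>h\<in>insert a S. u h \<bullet> c h) *
      F (\<lambda>h. if h \<in> insert a S then c h else u h))"
    unfolding sum_PiE_insert[OF insert.hyps] by (rule sum.swap)
  finally show ?case .
qed

lemma of_real_vec_add: "of_real_vec (y + z) = of_real_vec y + of_real_vec z"
  and of_real_vec_scaleR: "of_real_vec (r *\<^sub>R y) = scaleCx (of_real r) (of_real_vec y)"
  by (simp_all add: of_real_vec_def scaleCx_def)

text \<open>Each half-edge lies on exactly one vertex and occurs exactly once in its cyclic list, so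
  only one factor of the product depends on the vector at \<open>h\<close>, and it is linear in that vector.\<close>

lemma vertex_product_linear:
  fixes T :: "nat \<Rightarrow> 'a::real_vector complexification list \<Rightarrow> complex" and \<Gamma> :: "'h ribbon_graph"
  assumes \<Gamma>: "is_vertex_system \<Gamma>" and h: "h \<in> half_edges \<Gamma>"
    and T: "\<And>k. k \<ge> 1 \<Longrightarrow> complex_multilinear k (T k)"
  shows "real_linear_in h (vertex_product T \<Gamma>)"
proof -
  define w where "w = orbit (vperm \<Gamma>) h"
  have w: "w \<in> vertices \<Gamma>" "h \<in> w"
    using h permutation_self_in_orbit[OF vertex_systemD(3)[OF \<Gamma>]] by (auto simp: w_def vertices_def)
  let ?L = "cyclic_list \<Gamma> w"
  obtain i where i: "i < card w" "?L ! i = h"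
    using w(2) vertex_facts(5,6)[OF \<Gamma> w(1)] by (metis in_set_conv_nth)
  define R where "R u = (\<Prod>w'\<in>vertices \<Gamma> - {w}. T (card w') (map (\<lambda>h. of_real_vec (u h)) (cyclic_list \<Gamma> w')))"
    for u :: "'h \<Rightarrow> 'a"
  have split: "vertex_product T \<Gamma> (u(h := y)) =
      T (card w) ((map (\<lambda>h. of_real_vec (u h)) ?L)[i := of_real_vec y]) * R u" for u y
  proof -
    have "map (\<lambda>h'. of_real_vec ((u(h := y)) h')) ?L = (map (\<lambda>h. of_real_vec (u h)) ?L)[i := of_real_vec y]"
      using i vertex_facts(4,6)[OF \<Gamma> w(1)]
      by (intro nth_equalityI) (auto simp: nth_list_update nth_eq_iff_index_eq)
    moreover have "(\<Prod>w'\<in>vertices \<Gamma> - {w}. T (card w') (map (\<lambda>h'. of_real_vec ((u(h := y)) h')) (cyclic_list \<Gamma> w'))) = R u"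
      unfolding R_def
    proof (intro prod.cong refl arg_cong[where f = "T _"] map_cong)
      fix w' h' assume "w' \<in> vertices \<Gamma> - {w}" "h' \<in> set (cyclic_list \<Gamma> w')"
      then have "h' \<noteq> h" using vertices_disjoint[OF \<Gamma> w(1), of w' h] w(2) vertex_facts(5)[OF \<Gamma>, of w'] by auto
      then show "of_real_vec ((u(h := y)) h') = of_real_vec (u h')" by simp
    qed
    ultimately show ?thesis
      unfolding vertex_product_def by (simp add: prod.remove[OF finite_vertices[OF \<Gamma>] w(1)])
  qed
  have "complex_multilinear (card w) (T (card w))" by (intro T vertex_facts(7)[OF \<Gamma> w(1)])
  then have lin: "T (card w) (X[i := y + z]) = T (card w) (X[i := y]) + T (card w) (X[i := z])"
    "T (card w) (X[i := scaleCx c y]) = c * T (card w) (X[i := y])" if "length X = card w" for X y z c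
    using i(1) that unfolding complex_multilinear_def by blast+
  have len: "length (map (\<lambda>h. of_real_vec (u h)) ?L) = card w" for u :: "'h \<Rightarrow> 'a"
    using vertex_facts(6)[OF \<Gamma> w(1)] by simp
  show ?thesis
    unfolding real_linear_in_def split of_real_vec_add of_real_vec_scaleR lin[OF len]
    by (simp add: distrib_right mult.assoc)
qed

definition with_edges :: "'h ribbon_graph \<Rightarrow> ('h \<Rightarrow> 'h) \<Rightarrow> 'h ribbon_graph" where
  "with_edges \<Gamma> \<pi> = \<Gamma>\<lparr>eperm := \<pi>\<rparr>"

lemma with_edges_simps [simp]:
  "half_edges (with_edges \<Gamma> \<pi>) = half_edges \<Gamma>" "vperm (with_edges \<Gamma> \<pi>) = vperm \<Gamma>"
  "eperm (with_edges \<Gamma> \<pi>) = \<pi>" "vertex_product T (with_edges \<Gamma> \<pi>) = vertex_product T \<Gamma>"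
  by (simp_all add: with_edges_def vertex_product_def vertices_def cyclic_list_def fun_eq_iff)

lemma is_ribbon_graph_with_edges:
  assumes "is_vertex_system \<Gamma>" "\<pi> \<in> pairings (half_edges \<Gamma>)"
  shows "is_ribbon_graph (with_edges \<Gamma> \<pi>)"
  using assms by (auto simp: is_vertex_system_def is_ribbon_graph_def pairings_def)

text \<open>Expand the product over all colourings of the half-edges by basis vectors. By Wick's formula a
  colouring contributes once for each pairing that it is compatible with. Interchanging the two
  sums leaves, for each pairing, the sum over the compatible colourings, which is the graphical
  calculus of the graph obtained by joining the half-edges along the pairing.\<close>

lemma (in invariant_measure_space) integral_vertex_product:
  assumes \<Gamma>: "is_vertex_system \<Gamma>"
    and T: "\<And>k. k \<ge> 1 \<Longrightarrow> complex_multilinear k (T k)"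
  shows "integrable (gaussian_measure dv) (\<lambda>v. vertex_product T \<Gamma> (\<lambda>_. v))"
    and "(\<integral>v. vertex_product T \<Gamma> (\<lambda>_. v) \<partial>gaussian_measure dv) =
      (\<Sum>\<pi>\<in>pairings (half_edges \<Gamma>). graph_value B T (with_edges \<Gamma> \<pi>))"
proof -
  let ?H = "half_edges \<Gamma>" and ?V = "vertex_product T \<Gamma>"
  let ?C = "?H \<rightarrow>\<^sub>E B"
  have H: "finite ?H" by (rule vertex_systemD[OF \<Gamma>])
  have C: "finite ?C" by (intro finite_PiE H finite_basis)
  have expansion: "?V (\<lambda>_. v) = (\<Sum>c\<in>?C. of_real (\<Prod>h\<in>?H. v \<bullet> c h) * ?V c)" for v
  proof -
    have "?V (\<lambda>_. v) = (\<Sum>c\<in>?C. of_real (\<Prod>h\<in>?H. v \<bullet> c h) * ?V (\<lambda>h. if h \<in> ?H then c h else v))"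
      by (rule multilinear_expansion[OF H vertex_product_linear[OF \<Gamma> _ T]])
    also have "\<dots> = (\<Sum>c\<in>?C. of_real (\<Prod>h\<in>?H. v \<bullet> c h) * ?V c)"
      by (intro sum.cong refl arg_cong2[where f = "(*)"] vertex_product_cong[OF \<Gamma>]) simp
    finally show ?thesis .
  qed
  have wick: "integrable (gaussian_measure dv) (\<lambda>v. \<Prod>h\<in>?H. v \<bullet> c h)"
    "(\<integral>v. (\<Prod>h\<in>?H. v \<bullet> c h) \<partial>gaussian_measure dv) = real (card (compatible_pairings ?H c))"
    if "c \<in> ?C" for c
    using Wick[of ?H c] H that by auto
  have int: "integrable (gaussian_measure dv) (\<lambda>v. of_real (\<Prod>h\<in>?H. v \<bullet> c h) * ?V c)" if "c \<in> ?C" for c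
    using wick(1)[OF that] by (intro integrable_mult_left integrable_of_real)
  show "integrable (gaussian_measure dv) (\<lambda>v. ?V (\<lambda>_. v))"
    unfolding expansion by (intro Bochner_Integration.integrable_sum int)
  have "(\<integral>v. ?V (\<lambda>_. v) \<partial>gaussian_measure dv) =
      (\<Sum>c\<in>?C. \<integral>v. of_real (\<Prod>h\<in>?H. v \<bullet> c h) * ?V c \<partial>gaussian_measure dv)"
    unfolding expansion by (intro Bochner_Integration.integral_sum int)
  also have "\<dots> = (\<Sum>c\<in>?C. of_nat (card (compatible_pairings ?H c)) * ?V c)"
  proof (intro sum.cong refl)
    fix c assume c: "c \<in> ?C"
    have "(\<integral>v. of_real (\<Prod>h\<in>?H. v \<bullet> c h) * ?V c \<partial>gaussian_measure dv) =
        (\<integral>v. of_real (\<Prod>h\<in>?H. v \<bullet> c h) \<partial>gaussian_measure dv) * ?V c"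
      by (rule Bochner_Integration.integral_mult_left_zero)
    also have "(\<integral>v. complex_of_real (\<Prod>h\<in>?H. v \<bullet> c h) \<partial>gaussian_measure dv) =
        of_real (\<integral>v. (\<Prod>h\<in>?H. v \<bullet> c h) \<partial>gaussian_measure dv)"
      by (rule integral_of_real[OF wick(1)[OF c]])
    finally show "(\<integral>v. of_real (\<Prod>h\<in>?H. v \<bullet> c h) * ?V c \<partial>gaussian_measure dv) =
        of_nat (card (compatible_pairings ?H c)) * ?V c"
      by (simp add: wick(2)[OF c] del: of_real_prod)
  qed
  also have "\<dots> = (\<Sum>c\<in>?C. \<Sum>\<pi>\<in>pairings ?H. if \<forall>h\<in>?H. c (\<pi> h) = c h then ?V c else 0)"
    using finite_pairings[OF H]
    by (intro sum.cong refl) (simp add: compatible_pairings_def sum.inter_filter[symmetric])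
  also have "\<dots> = (\<Sum>\<pi>\<in>pairings ?H. \<Sum>c\<in>?C. if \<forall>h\<in>?H. c (\<pi> h) = c h then ?V c else 0)"
    by (rule sum.swap)
  also have "\<dots> = (\<Sum>\<pi>\<in>pairings ?H. graph_value B T (with_edges \<Gamma> \<pi>))"
    using C by (intro sum.cong refl)
      (simp add: graph_value_eq_sum_edge_colourings[OF is_ribbon_graph_with_edges[OF \<Gamma>]]
        edge_colourings_def sum.inter_filter[symmetric])
  finally show "(\<integral>v. ?V (\<lambda>_. v) \<partial>gaussian_measure dv) =
      (\<Sum>\<pi>\<in>pairings ?H. graph_value B T (with_edges \<Gamma> \<pi>))" .
qed

lemma vertex_product_const:
  assumes "is_vertex_system \<Gamma>"
  shows "vertex_product T \<Gamma> (\<lambda>_. v) =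
    (\<Prod>k\<in>#cycle_type (half_edges \<Gamma>) (vperm \<Gamma>). T k (replicate k (of_real_vec v)))"
proof -
  have "vertex_product T \<Gamma> (\<lambda>_. v) = (\<Prod>w\<in>vertices \<Gamma>. T (card w) (replicate (card w) (of_real_vec v)))"
    by (simp add: vertex_product_def map_replicate_const cyclic_list_def)
  then show ?thesis
    by (simp add: prod_unfold_prod_mset cycle_type_def vertices_def image_mset.compositionality comp_def)
qed

section \<open>Isomorphism invariance of the graphical calculus\<close>

text \<open>Starting one step further around the cycle rotates the list of arguments by one place.\<close>

lemma cyclic_value_independent_of_start:
  assumes \<sigma>: "permutation \<sigma>" and cyc: "cyclically_invariant (card (orbit \<sigma> x)) t"
    and y: "y \<in> orbit \<sigma> x"
  shows "t (map (\<lambda>i. g ((\<sigma> ^^ i) y)) [0..<card (orbit \<sigma> x)]) =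
    t (map (\<lambda>i. g ((\<sigma> ^^ i) x)) [0..<card (orbit \<sigma> x)])"
proof -
  let ?k = "card (orbit \<sigma> x)"
  obtain j where j: "?k = Suc j" using card_orbit_pos[OF \<sigma>, of x] gr0_implies_Suc by blast
  have step: "t (map (\<lambda>i. g ((\<sigma> ^^ i) (\<sigma> z))) [0..<?k]) = t (map (\<lambda>i. g ((\<sigma> ^^ i) z)) [0..<?k])"
    if z: "orbit \<sigma> z = orbit \<sigma> x" for z
  proof -
    let ?X = "map (\<lambda>i. g ((\<sigma> ^^ Suc i) z)) [0..<j]"
    have "(\<sigma> ^^ Suc j) z = z" using orbit_funpow(1)[OF \<sigma>, of z] z j by simp
    then have "map (\<lambda>i. g ((\<sigma> ^^ i) (\<sigma> z))) [0..<?k] = ?X @ [g z]"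
      unfolding j by (simp add: funpow_swap1)
    moreover have "map (\<lambda>i. g ((\<sigma> ^^ i) z)) [0..<?k] = g z # ?X"
      unfolding j by (simp add: upt_conv_Cons map_Suc_upt[symmetric] comp_def del: upt_Suc)
    moreover have "t (?X @ [g z]) = t (g z # ?X)"
      using cyc unfolding cyclically_invariant_def j by (metis length_append_singleton length_map length_upt minus_nat.diff_0)
    ultimately show ?thesis by simp
  qed
  show ?thesis using y
  proof induction
    case base
    then show ?case by (rule step) simp
  next
    case (step z)
    then show ?case using \<open>\<And>z. orbit \<sigma> z = orbit \<sigma> x \<Longrightarrow> _\<close>[of z] orbit_eq_of_mem[OF \<sigma> step.hyps] by simp
  qed
qed

text \<open>An isomorphism maps the cyclic list of a vertex to a cyclic list of the image vertex, though
  perhaps with another starting point. This is where cyclic invariance enters.\<close>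

lemma vertex_product_isomorphism:
  assumes \<Gamma>: "is_ribbon_graph \<Gamma>" and \<Gamma>': "is_ribbon_graph \<Gamma>'"
    and f: "bij_betw f (half_edges \<Gamma>) (half_edges \<Gamma>')"
      "\<And>h. h \<in> half_edges \<Gamma> \<Longrightarrow> f (vperm \<Gamma> h) = vperm \<Gamma>' (f h)"
    and T: "\<And>k. k \<ge> 1 \<Longrightarrow> cyclically_invariant k (T k)"
  shows "vertex_product T \<Gamma>' u = vertex_product T \<Gamma> (u \<circ> f)"
proof -
  note closed = ribbon_graphD(4)[OF \<Gamma>]
  have orb: "orbit (vperm \<Gamma>') (f h) = f ` orbit (vperm \<Gamma>) h" if "h \<in> half_edges \<Gamma>" for h
    by (rule equivariant_orbit[where S = "half_edges \<Gamma>"])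
       (use ribbon_graphD(3)[OF \<Gamma>] closed f(2) that in auto)
  have inj: "inj_on ((`) f) (vertices \<Gamma>)"
    using vertex_facts(1)[OF ribbon_vertex_system[OF \<Gamma>]] f(1)
    by (intro inj_onI) (metis bij_betw_def inj_on_image_eq_iff)
  have "(`) f ` vertices \<Gamma> = orbit (vperm \<Gamma>') ` (f ` half_edges \<Gamma>)"
    unfolding vertices_def image_image using orb by (intro image_cong) auto
  then have vertices': "(`) f ` vertices \<Gamma> = vertices \<Gamma>'"
    using f(1) by (simp add: vertices_def bij_betw_def)
  have "vertex_product T \<Gamma>' u =
      (\<Prod>w\<in>vertices \<Gamma>. T (card (f ` w)) (map (\<lambda>h. of_real_vec (u h)) (cyclic_list \<Gamma>' (f ` w))))"
    unfolding vertex_product_def vertices'[symmetric] by (subst prod.reindex[OF inj]) simp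
  also have "\<dots> = (\<Prod>w\<in>vertices \<Gamma>. T (card w) (map (\<lambda>h. of_real_vec ((u \<circ> f) h)) (cyclic_list \<Gamma> w)))"
  proof (intro prod.cong refl)
    fix w assume w: "w \<in> vertices \<Gamma>"
    define s where "s = (SOME h. h \<in> w)"
    define s' where "s' = (SOME h. h \<in> f ` w)"
    have sw: "s \<in> w" unfolding s_def by (rule vertex_facts(2)[OF ribbon_vertex_system[OF \<Gamma>] w])
    then have s: "s \<in> half_edges \<Gamma>" using vertex_facts(1)[OF ribbon_vertex_system[OF \<Gamma>] w] by auto
    have orb_s: "orbit (vperm \<Gamma>) s = w" by (rule vertex_facts(3)[OF ribbon_vertex_system[OF \<Gamma>] w sw])
    have orb_fs: "orbit (vperm \<Gamma>') (f s) = f ` w" using orb[OF s] orb_s by simp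
    have s': "s' \<in> orbit (vperm \<Gamma>') (f s)"
      unfolding orb_fs s'_def using vertex_facts(2)[OF ribbon_vertex_system[OF \<Gamma>'], of "f ` w"] w vertices' by blast
    have "inj_on f w" using f(1) vertex_facts(1)[OF ribbon_vertex_system[OF \<Gamma>] w] by (meson bij_betw_def inj_on_subset)
    then have card: "card (f ` w) = card w" by (rule card_image)
    have "map (\<lambda>h. of_real_vec ((u \<circ> f) h)) (cyclic_list \<Gamma> w) =
        map (\<lambda>i. of_real_vec (u ((vperm \<Gamma>' ^^ i) (f s)))) [0..<card w]"
      using equivariant_funpow[of "half_edges \<Gamma>" "vperm \<Gamma>" f "vperm \<Gamma>'" s] closed f(2) s
      by (simp add: cyclic_list_def s_def[symmetric])
    moreover have "map (\<lambda>h. of_real_vec (u h)) (cyclic_list \<Gamma>' (f ` w)) =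
        map (\<lambda>i. of_real_vec (u ((vperm \<Gamma>' ^^ i) s'))) [0..<card w]"
      by (simp add: cyclic_list_def s'_def[symmetric] card)
    moreover have "cyclically_invariant (card w) (T (card w))"
      by (intro T vertex_facts(7)[OF ribbon_vertex_system[OF \<Gamma>] w])
    ultimately show "T (card (f ` w)) (map (\<lambda>h. of_real_vec (u h)) (cyclic_list \<Gamma>' (f ` w))) =
        T (card w) (map (\<lambda>h. of_real_vec ((u \<circ> f) h)) (cyclic_list \<Gamma> w))"
      using cyclic_value_independent_of_start[OF ribbon_graphD(3)[OF \<Gamma>'], of "f s" "T (card w)" s' "\<lambda>h. of_real_vec (u h)"]
        s' by (simp add: orb_fs card)
  qed
  finally show ?thesis by (simp add: vertex_product_def)
qed

lemma graph_value_isomorphic: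
  assumes \<Gamma>: "is_ribbon_graph \<Gamma>" and \<Gamma>': "is_ribbon_graph \<Gamma>'" and iso: "isomorphic \<Gamma> \<Gamma>'"
    and T: "\<And>k. k \<ge> 1 \<Longrightarrow> cyclically_invariant k (T k)"
  shows "graph_value B T \<Gamma> = graph_value B T \<Gamma>'"
proof -
  let ?H = "half_edges \<Gamma>" and ?H' = "half_edges \<Gamma>'"
  obtain f where f: "bij_betw f ?H ?H'" "\<And>h. h \<in> ?H \<Longrightarrow> f (vperm \<Gamma> h) = vperm \<Gamma>' (f h)"
    "\<And>h. h \<in> ?H \<Longrightarrow> f (eperm \<Gamma> h) = eperm \<Gamma>' (f h)"
    using iso by (auto simp: isomorphic_def commutes_with_structure_def)
  let ?g = "inv_into ?H f"
  have fH: "f h \<in> ?H'" if "h \<in> ?H" for h using f(1) that by (auto simp: bij_betw_def)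
  have g: "?g h' \<in> ?H" "f (?g h') = h'" if "h' \<in> ?H'" for h'
    using f(1) that by (auto simp: bij_betw_def inv_into_into f_inv_into_f)
  have gf: "?g (f h) = h" if "h \<in> ?H" for h using f(1) that by (auto simp: bij_betw_def)
  have g_eperm: "?g (eperm \<Gamma>' h') = eperm \<Gamma> (?g h')" if "h' \<in> ?H'" for h'
    using f(3)[of "?g h'"] g[OF that] gf[of "eperm \<Gamma> (?g h')"] ribbon_graphD(6)[OF \<Gamma>] by simp
  have "(\<Sum>c\<in>edge_colourings B \<Gamma>. vertex_product T \<Gamma> c) = (\<Sum>c\<in>edge_colourings B \<Gamma>'. vertex_product T \<Gamma>' c)"
  proof (rule sum.reindex_bij_witness[where j = "\<lambda>c. restrict (c \<circ> ?g) ?H'" and i = "\<lambda>c. restrict (c \<circ> f) ?H"])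
    fix c assume c: "c \<in> edge_colourings B \<Gamma>"
    then have cB: "\<And>h. h \<in> ?H \<Longrightarrow> c h \<in> B" "\<And>h. h \<in> ?H \<Longrightarrow> c (eperm \<Gamma> h) = c h"
      "\<And>h. h \<notin> ?H \<Longrightarrow> c h = undefined"
      by (auto simp: edge_colourings_def PiE_def extensional_def)
    show "restrict (restrict (c \<circ> ?g) ?H' \<circ> f) ?H = c"
      using fH gf cB(3) by (auto simp: fun_eq_iff)
    show "restrict (c \<circ> ?g) ?H' \<in> edge_colourings B \<Gamma>'"
      using g g_eperm cB ribbon_graphD(6)[OF \<Gamma>'] by (auto simp: edge_colourings_def)
    have "vertex_product T \<Gamma>' (restrict (c \<circ> ?g) ?H') = vertex_product T \<Gamma> (restrict (c \<circ> ?g) ?H' \<circ> f)"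
      by (rule vertex_product_isomorphism[OF \<Gamma> \<Gamma>' f(1,2) T])
    also have "\<dots> = vertex_product T \<Gamma> c"
      by (rule vertex_product_cong[OF ribbon_vertex_system[OF \<Gamma>]]) (simp add: fH gf)
    finally show "vertex_product T \<Gamma>' (restrict (c \<circ> ?g) ?H') = vertex_product T \<Gamma> c" .
  next
    fix c assume c: "c \<in> edge_colourings B \<Gamma>'"
    then have cB: "\<And>h. h \<in> ?H' \<Longrightarrow> c h \<in> B" "\<And>h. h \<in> ?H' \<Longrightarrow> c (eperm \<Gamma>' h) = c h"
      "\<And>h. h \<notin> ?H' \<Longrightarrow> c h = undefined"
      by (auto simp: edge_colourings_def PiE_def extensional_def)
    show "restrict (restrict (c \<circ> f) ?H \<circ> ?g) ?H' = c"
      using g cB(3) by (auto simp: fun_eq_iff)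
    show "restrict (c \<circ> f) ?H \<in> edge_colourings B \<Gamma>"
      using fH f(3) cB ribbon_graphD(6)[OF \<Gamma>] by (auto simp: edge_colourings_def)
  qed
  then show ?thesis
    by (simp add: graph_value_eq_sum_edge_colourings[OF \<Gamma>] graph_value_eq_sum_edge_colourings[OF \<Gamma>'])
qed

section \<open>Counting pairings that yield a given graph\<close>

text \<open>Extensional functions on the half-edges, so that isomorphisms can be counted.\<close>

definition isomorphisms :: "'h ribbon_graph \<Rightarrow> 'g ribbon_graph \<Rightarrow> ('h \<Rightarrow> 'g) set" where
  "isomorphisms \<Gamma> \<Gamma>' =
     {f \<in> equivariant_bijections (half_edges \<Gamma>) (vperm \<Gamma>) (half_edges \<Gamma>') (vperm \<Gamma>').
       \<forall>h\<in>half_edges \<Gamma>. f (eperm \<Gamma> h) = eperm \<Gamma>' (f h)}"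

lemma isomorphic_iff:
  assumes "is_ribbon_graph \<Gamma>"
  shows "isomorphic \<Gamma> \<Gamma>' \<longleftrightarrow> isomorphisms \<Gamma> \<Gamma>' \<noteq> {}"
proof
  assume "isomorphic \<Gamma> \<Gamma>'"
  then obtain f where f: "bij_betw f (half_edges \<Gamma>) (half_edges \<Gamma>')" "commutes_with_structure \<Gamma> \<Gamma>' f"
    unfolding isomorphic_def by blast
  let ?f = "restrict f (half_edges \<Gamma>)"
  have b: "bij_betw ?f (half_edges \<Gamma>) (half_edges \<Gamma>')" using f(1) by simp
  have "?f \<in> half_edges \<Gamma> \<rightarrow>\<^sub>E half_edges \<Gamma>'"
    using bij_betw_imp_surj_on[OF f(1)] by auto
  then have "?f \<in> isomorphisms \<Gamma> \<Gamma>'"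
    unfolding isomorphisms_def equivariant_bijections_def
    using b f(2) ribbon_graphD(4,6)[OF assms] by (simp add: commutes_with_structure_def)
  then show "isomorphisms \<Gamma> \<Gamma>' \<noteq> {}" by blast
next
  assume "isomorphisms \<Gamma> \<Gamma>' \<noteq> {}"
  then obtain f where "f \<in> isomorphisms \<Gamma> \<Gamma>'" by blast
  then have "bij_betw f (half_edges \<Gamma>) (half_edges \<Gamma>') \<and> commutes_with_structure \<Gamma> \<Gamma>' f"
    by (simp add: isomorphisms_def equivariant_bijections_def commutes_with_structure_def)
  then show "isomorphic \<Gamma> \<Gamma>'" unfolding isomorphic_def by blast
qed

lemma isomorphic_cycle_type:
  assumes \<Gamma>: "is_ribbon_graph \<Gamma>" and "isomorphic \<Gamma> \<Gamma>'"
  shows "cycle_type (half_edges \<Gamma>) (vperm \<Gamma>) = cycle_type (half_edges \<Gamma>') (vperm \<Gamma>')"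
proof -
  let ?H = "half_edges \<Gamma>" and ?O = "orbit (vperm \<Gamma>) ` half_edges \<Gamma>"
  obtain f where f: "bij_betw f ?H (half_edges \<Gamma>')" "\<And>h. h \<in> ?H \<Longrightarrow> f (vperm \<Gamma> h) = vperm \<Gamma>' (f h)"
    using assms(2) by (auto simp: isomorphic_def commutes_with_structure_def)
  have sub: "w \<subseteq> ?H" if "w \<in> ?O" for w
    using vertex_facts(1)[OF ribbon_vertex_system[OF \<Gamma>]] that by (simp add: vertices_def)
  have orb: "orbit (vperm \<Gamma>') (f h) = f ` orbit (vperm \<Gamma>) h" if "h \<in> ?H" for h
    by (rule equivariant_orbit[where S = ?H]) (use ribbon_graphD(3,4)[OF \<Gamma>] f(2) that in auto)
  have inj: "inj_on ((`) f) ?O"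
    using sub f(1) by (intro inj_onI) (metis bij_betw_def inj_on_image_eq_iff)
  have "orbit (vperm \<Gamma>') ` half_edges \<Gamma>' = (`) f ` ?O"
    unfolding bij_betw_imp_surj_on[OF f(1), symmetric] image_image using orb by (intro image_cong) auto
  then have "cycle_type (half_edges \<Gamma>') (vperm \<Gamma>') = image_mset card (image_mset ((`) f) (mset_set ?O))"
    unfolding cycle_type_def by (simp add: image_mset_mset_set[OF inj])
  also have "\<dots> = image_mset card (mset_set ?O)"
    unfolding multiset.map_comp
  proof (intro image_mset_cong)
    fix w assume "w \<in># mset_set ?O"
    then have "w \<subseteq> ?H" using sub ribbon_graphD(1)[OF \<Gamma>] by simp
    with bij_betw_imp_inj_on[OF f(1)] have "inj_on f w" by (rule inj_on_subset)
    then show "(card \<circ> (`) f) w = card w" by (simp add: card_image)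
  qed
  finally show ?thesis by (simp add: cycle_type_def)
qed

text \<open>Composition with one fixed isomorphism identifies automorphisms with isomorphisms.\<close>

lemma card_isomorphisms:
  assumes \<Gamma>: "is_ribbon_graph \<Gamma>" and "isomorphic \<Gamma> \<Gamma>'"
  shows "card (isomorphisms \<Gamma> \<Gamma>') = card (Aut \<Gamma>)"
proof -
  let ?H = "half_edges \<Gamma>"
  obtain f where "f \<in> isomorphisms \<Gamma> \<Gamma>'" using assms isomorphic_iff[OF \<Gamma>] by auto
  then have f: "bij_betw f ?H (half_edges \<Gamma>')" "\<And>h. h \<in> ?H \<Longrightarrow> f (vperm \<Gamma> h) = vperm \<Gamma>' (f h)"
    "\<And>h. h \<in> ?H \<Longrightarrow> f (eperm \<Gamma> h) = eperm \<Gamma>' (f h)"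
    by (auto simp: isomorphisms_def equivariant_bijections_def)
  let ?g = "inv_into ?H f"
  have gf: "?g (f h) = h" if "h \<in> ?H" for h using f(1) that by (auto simp: bij_betw_def)
  have fg: "?g h' \<in> ?H" "f (?g h') = h'" if "h' \<in> half_edges \<Gamma>'" for h'
    using f(1) that by (auto simp: bij_betw_def inv_into_into f_inv_into_f)
  have g_comm: "?g (vperm \<Gamma>' h') = vperm \<Gamma> (?g h')" "?g (eperm \<Gamma>' h') = eperm \<Gamma> (?g h')"
    if "h' \<in> half_edges \<Gamma>'" for h'
    using f(2,3)[of "?g h'"] fg[OF that] gf[of "eperm \<Gamma> (?g h')"] gf[of "vperm \<Gamma> (?g h')"]
      ribbon_graphD(4,6)[OF \<Gamma>] by simp_all
  have "bij_betw (\<lambda>a. restrict (f \<circ> a) ?H) (Aut \<Gamma>) (isomorphisms \<Gamma> \<Gamma>')"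
  proof (rule bij_betw_byWitness[where f' = "\<lambda>f' h. if h \<in> ?H then ?g (f' h) else h"])
    show "\<forall>a\<in>Aut \<Gamma>. (\<lambda>h. if h \<in> ?H then ?g (restrict (f \<circ> a) ?H h) else h) = a"
      using gf by (auto simp: Aut_def fun_eq_iff permutes_in_image permutes_not_in)
    show "\<forall>f'\<in>isomorphisms \<Gamma> \<Gamma>'. restrict (f \<circ> (\<lambda>h. if h \<in> ?H then ?g (f' h) else h)) ?H = f'"
      using fg(2) by (auto simp: isomorphisms_def equivariant_bijections_def fun_eq_iff PiE_def extensional_def Pi_def)
    show "(\<lambda>a. restrict (f \<circ> a) ?H) ` Aut \<Gamma> \<subseteq> isomorphisms \<Gamma> \<Gamma>'"
    proof (rule image_subsetI)
      fix a assume "a \<in> Aut \<Gamma>"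
      then have a: "a permutes ?H" "\<And>h. h \<in> ?H \<Longrightarrow> a (vperm \<Gamma> h) = vperm \<Gamma> (a h)"
        "\<And>h. h \<in> ?H \<Longrightarrow> a (eperm \<Gamma> h) = eperm \<Gamma> (a h)"
        by (auto simp: Aut_def commutes_with_structure_def)
      have aH: "a h \<in> ?H" if "h \<in> ?H" for h using a(1) that by (simp add: permutes_in_image)
      have b: "bij_betw (restrict (f \<circ> a) ?H) ?H (half_edges \<Gamma>')"
        using bij_betw_trans[OF permutes_imp_bij[OF a(1)] f(1)] by simp
      then have "restrict (f \<circ> a) ?H \<in> ?H \<rightarrow>\<^sub>E half_edges \<Gamma>'"
        unfolding bij_betw_def by (auto simp: PiE_def)
      with b show "restrict (f \<circ> a) ?H \<in> isomorphisms \<Gamma> \<Gamma>'"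
        using a f aH ribbon_graphD(4,6)[OF \<Gamma>]
        by (auto simp: isomorphisms_def equivariant_bijections_def)
    qed
    show "(\<lambda>f' h. if h \<in> ?H then ?g (f' h) else h) ` isomorphisms \<Gamma> \<Gamma>' \<subseteq> Aut \<Gamma>"
    proof (rule image_subsetI)
      fix f' assume "f' \<in> isomorphisms \<Gamma> \<Gamma>'"
      then have f': "bij_betw f' ?H (half_edges \<Gamma>')" "\<And>h. h \<in> ?H \<Longrightarrow> f' (vperm \<Gamma> h) = vperm \<Gamma>' (f' h)"
        "\<And>h. h \<in> ?H \<Longrightarrow> f' (eperm \<Gamma> h) = eperm \<Gamma>' (f' h)"
        by (auto simp: isomorphisms_def equivariant_bijections_def)
      have f'H: "f' h \<in> half_edges \<Gamma>'" if "h \<in> ?H" for h using f'(1) that by (auto simp: bij_betw_def)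
      let ?a = "\<lambda>h. if h \<in> ?H then ?g (f' h) else h"
      have "bij_betw (?g \<circ> f') ?H ?H"
        by (rule bij_betw_trans[OF f'(1) bij_betw_inv_into[OF f(1)]])
      then have "bij_betw ?a ?H ?H" using bij_betw_cong[of ?H ?a "?g \<circ> f'"] by simp
      then have "?a permutes ?H" by (rule bij_imp_permutes) simp
      then show "?a \<in> Aut \<Gamma>"
        using f' f'H g_comm ribbon_graphD(4,6)[OF \<Gamma>]
        by (auto simp: Aut_def commutes_with_structure_def)
    qed
  qed
  then show ?thesis by (simp add: bij_betw_same_card)
qed

text \<open>This is the orbit-stabilizer theorem, obtained by counting equivariant bijections from the
  vertices of \<open>\<Gamma>\<close> to those of \<open>\<Delta>\<close>. Each bijection transports the edges of \<open>\<Gamma>\<close> to exactly one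
  pairing on \<open>\<Delta>\<close> and is an isomorphism onto the resulting graph. Conversely each pairing that
  yields a graph isomorphic to \<open>\<Gamma>\<close> arises from as many bijections as \<open>\<Gamma>\<close> has automorphisms.\<close>

lemma card_pairings_isomorphic:
  assumes \<Gamma>: "is_ribbon_graph \<Gamma>" and \<Delta>: "is_vertex_system \<Delta>"
    and type: "cycle_type (half_edges \<Gamma>) (vperm \<Gamma>) = cycle_type (half_edges \<Delta>) (vperm \<Delta>)"
  shows "card {\<pi> \<in> pairings (half_edges \<Delta>). isomorphic \<Gamma> (with_edges \<Delta> \<pi>)} * card (Aut \<Gamma>) =
    centralizer_order (cycle_type (half_edges \<Gamma>) (vperm \<Gamma>))"
proof -
  let ?H = "half_edges \<Gamma>" and ?K = "half_edges \<Delta>"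
  let ?E = "equivariant_bijections ?H (vperm \<Gamma>) ?K (vperm \<Delta>)"
  let ?P = "{\<pi> \<in> pairings ?K. isomorphic \<Gamma> (with_edges \<Delta> \<pi>)}"
  have finite: "finite ?P" "finite ?E"
    using finite_pairings[OF vertex_systemD(1)[OF \<Delta>]]
      finite_equivariant_bijections[OF ribbon_graphD(1)[OF \<Gamma>] vertex_systemD(1)[OF \<Delta>]] by simp_all
  have iso: "isomorphisms \<Gamma> (with_edges \<Delta> \<pi>) = {f \<in> ?E. \<forall>h\<in>?H. f (eperm \<Gamma> h) = \<pi> (f h)}" for \<pi>
    by (simp add: isomorphisms_def)
  have transported: "\<exists>\<pi>\<in>?P. f \<in> isomorphisms \<Gamma> (with_edges \<Delta> \<pi>)" if f: "f \<in> ?E" for f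
  proof -
    have f': "bij_betw f ?H ?K" using f by (simp add: equivariant_bijections_def)
    let ?g = "inv_into ?H f"
    have gf: "?g (f h) = h" if "h \<in> ?H" for h using f' that by (auto simp: bij_betw_def)
    have fH: "f h \<in> ?K" if "h \<in> ?H" for h using f' that by (auto simp: bij_betw_def)
    have fg: "?g x \<in> ?H" "f (?g x) = x" if "x \<in> ?K" for x
      using f' that by (auto simp: bij_betw_def inv_into_into f_inv_into_f)
    define \<pi> where "\<pi> x = (if x \<in> ?K then f (eperm \<Gamma> (?g x)) else x)" for x
    have \<pi>K: "\<pi> x \<in> ?K" "\<pi> (\<pi> x) = x" "\<pi> x \<noteq> x" if x: "x \<in> ?K" for x
    proof -
      let ?h = "?g x"
      have h: "?h \<in> ?H" "eperm \<Gamma> ?h \<in> ?H" using fg[OF x] ribbon_graphD(6)[OF \<Gamma>] by auto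
      show "\<pi> x \<in> ?K" using x fH h by (simp add: \<pi>_def)
      then show "\<pi> (\<pi> x) = x" using x h gf fg[OF x] ribbon_graphD(7)[OF \<Gamma>] by (simp add: \<pi>_def)
      have "eperm \<Gamma> ?h \<noteq> ?h" using \<Gamma> h by (simp add: is_ribbon_graph_def)
      then show "\<pi> x \<noteq> x" using x h gf[OF h(2)] by (auto simp: \<pi>_def)
    qed
    have "bij_betw \<pi> ?K ?K"
      by (rule bij_betw_byWitness[where f' = \<pi>]) (use \<pi>K in auto)
    then have "\<pi> permutes ?K" by (rule bij_imp_permutes) (simp add: \<pi>_def)
    then have \<pi>: "\<pi> \<in> pairings ?K" using \<pi>K by (auto simp: pairings_def)
    have "f \<in> isomorphisms \<Gamma> (with_edges \<Delta> \<pi>)"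
      unfolding iso using f gf fH by (auto simp: \<pi>_def)
    then show ?thesis using \<pi> isomorphic_iff[OF \<Gamma>] by blast
  qed
  have unique: "\<pi> = \<pi>'" if "\<pi> \<in> ?P" "\<pi>' \<in> ?P" "f \<in> isomorphisms \<Gamma> (with_edges \<Delta> \<pi>)"
    "f \<in> isomorphisms \<Gamma> (with_edges \<Delta> \<pi>')" for f \<pi> \<pi>'
  proof
    fix x
    show "\<pi> x = \<pi>' x"
    proof (cases "x \<in> ?K")
      case True
      moreover have "bij_betw f ?H ?K" using that(3) by (simp add: iso equivariant_bijections_def)
      ultimately obtain h where "h \<in> ?H" "x = f h" by (auto simp: bij_betw_def)
      then show ?thesis using that(3,4) unfolding iso by auto
    next
      case False
      then show ?thesis using that(1,2) by (auto simp: pairings_def permutes_not_in)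
    qed
  qed
  have "?E = (\<Union>\<pi>\<in>?P. isomorphisms \<Gamma> (with_edges \<Delta> \<pi>))"
  proof
    show "?E \<subseteq> (\<Union>\<pi>\<in>?P. isomorphisms \<Gamma> (with_edges \<Delta> \<pi>))" using transported by blast
    show "(\<Union>\<pi>\<in>?P. isomorphisms \<Gamma> (with_edges \<Delta> \<pi>)) \<subseteq> ?E" unfolding iso by auto
  qed
  then have "card ?E = card (\<Union>\<pi>\<in>?P. isomorphisms \<Gamma> (with_edges \<Delta> \<pi>))" by simp
  also have "\<dots> = (\<Sum>\<pi>\<in>?P. card (isomorphisms \<Gamma> (with_edges \<Delta> \<pi>)))"
  proof (rule card_UN_disjoint)
    show "\<forall>\<pi>\<in>?P. finite (isomorphisms \<Gamma> (with_edges \<Delta> \<pi>))"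
      unfolding iso using finite(2) by simp
    show "\<forall>\<pi>\<in>?P. \<forall>\<pi>'\<in>?P. \<pi> \<noteq> \<pi>' \<longrightarrow>
        isomorphisms \<Gamma> (with_edges \<Delta> \<pi>) \<inter> isomorphisms \<Gamma> (with_edges \<Delta> \<pi>') = {}"
      using unique by blast
  qed (rule finite)
  also have "\<dots> = (\<Sum>\<pi>\<in>?P. card (Aut \<Gamma>))"
    by (intro sum.cong refl card_isomorphisms[OF \<Gamma>]) simp
  also have "\<dots> = card ?P * card (Aut \<Gamma>)" by simp
  finally show ?thesis
    using card_equivariant_bijections[OF ribbon_graphD(3)[OF \<Gamma>] vertex_systemD(3)[OF \<Delta>]
        ribbon_graphD(1)[OF \<Gamma>] vertex_systemD(1)[OF \<Delta>] ribbon_graphD(4)[OF \<Gamma>] vertex_systemD(4)[OF \<Delta>] type]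
    by simp
qed

section \<open>Summation over isomorphism classes\<close>

definition isomorphism_relation :: "(nat ribbon_graph \<times> nat ribbon_graph) set" where
  "isomorphism_relation = {(\<Gamma>, \<Gamma>'). is_ribbon_graph \<Gamma> \<and> is_ribbon_graph \<Gamma>' \<and> isomorphic \<Gamma> \<Gamma>'}"

lemma isomorphic_sym:
  assumes \<Gamma>: "is_ribbon_graph \<Gamma>" and "isomorphic \<Gamma> \<Gamma>'"
  shows "isomorphic \<Gamma>' \<Gamma>"
proof -
  obtain f where f: "bij_betw f (half_edges \<Gamma>) (half_edges \<Gamma>')" "commutes_with_structure \<Gamma> \<Gamma>' f"
    using assms(2) by (auto simp: isomorphic_def)
  let ?g = "inv_into (half_edges \<Gamma>) f"
  have "?g (vperm \<Gamma>' h') = vperm \<Gamma> (?g h') \<and> ?g (eperm \<Gamma>' h') = eperm \<Gamma> (?g h')"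
    if h': "h' \<in> half_edges \<Gamma>'" for h'
  proof -
    obtain h where h: "h \<in> half_edges \<Gamma>" "h' = f h" using f(1) h' by (auto simp: bij_betw_def)
    then have "vperm \<Gamma>' h' = f (vperm \<Gamma> h)" "eperm \<Gamma>' h' = f (eperm \<Gamma> h)"
      using f(2) by (auto simp: commutes_with_structure_def)
    then show ?thesis
      using h f(1) ribbon_graphD(4,6)[OF \<Gamma> h(1)] by (simp add: bij_betw_inv_into_left)
  qed
  then show ?thesis
    using bij_betw_inv_into[OF f(1)] unfolding isomorphic_def commutes_with_structure_def by blast
qed

lemma isomorphic_trans:
  assumes "isomorphic \<Gamma> \<Gamma>'" "isomorphic \<Gamma>' \<Gamma>''"
  shows "isomorphic \<Gamma> \<Gamma>''"
proof -
  obtain f g where f: "bij_betw f (half_edges \<Gamma>) (half_edges \<Gamma>')" "commutes_with_structure \<Gamma> \<Gamma>' f"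
    and g: "bij_betw g (half_edges \<Gamma>') (half_edges \<Gamma>'')" "commutes_with_structure \<Gamma>' \<Gamma>'' g"
    using assms by (auto simp: isomorphic_def)
  have "f h \<in> half_edges \<Gamma>'" if "h \<in> half_edges \<Gamma>" for h using f(1) that by (auto simp: bij_betw_def)
  then have "commutes_with_structure \<Gamma> \<Gamma>'' (g \<circ> f)"
    using f(2) g(2) by (auto simp: commutes_with_structure_def)
  then show ?thesis
    using bij_betw_trans[OF f(1) g(1)] unfolding isomorphic_def by blast
qed

lemma isomorphic_refl: "isomorphic \<Gamma> \<Gamma>"
  unfolding isomorphic_def commutes_with_structure_def by (intro exI[of _ id]) auto

lemma equiv_isomorphism_relation: "equiv {\<Gamma>. is_ribbon_graph \<Gamma>} isomorphism_relation"
proof (rule equivI)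
  show "refl_on {\<Gamma>. is_ribbon_graph \<Gamma>} isomorphism_relation"
    by (auto simp: refl_on_def isomorphism_relation_def isomorphic_refl)
  show "sym isomorphism_relation" by (auto simp: sym_def isomorphism_relation_def intro: isomorphic_sym)
  show "trans isomorphism_relation" unfolding trans_def isomorphism_relation_def by (auto intro: isomorphic_trans)
qed (auto simp: isomorphism_relation_def)

lemma R00_eq: "R00 = {\<Gamma>. is_ribbon_graph \<Gamma>} // isomorphism_relation"
  by (simp add: R00_def isomorphism_relation_def)

lemma representative_in:
  assumes "C \<in> R00"
  shows "representative C \<in> C" "is_ribbon_graph (representative C)" "C = isomorphism_relation `` {representative C}"
proof -
  show r: "representative C \<in> C"
    using in_quotient_imp_non_empty[OF equiv_isomorphism_relation] assms
    by (auto simp: representative_def R00_eq some_in_eq)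
  show "is_ribbon_graph (representative C)"
    using r in_quotient_imp_subset[OF equiv_isomorphism_relation] assms by (auto simp: R00_eq)
  show "C = isomorphism_relation `` {representative C}"
    using assms r by (auto simp: R00_eq quotient_def) (metis equiv_class_eq equiv_isomorphism_relation Image_singleton_iff)+
qed

text \<open>Group the pairings by the isomorphism class of the resulting graph. Every class with the right
  valences is reached, because the number of pairings leading to it, times the order of the
  automorphism group, is the positive number \<^term>\<open>centralizer_order m\<close>.\<close>

theorem sum_pairings_eq_sum_classes:
  fixes T :: "nat \<Rightarrow> 'a::real_inner complexification list \<Rightarrow> complex" and \<Delta> :: "nat ribbon_graph"
  assumes \<Delta>: "is_vertex_system \<Delta>" and m: "m = cycle_type (half_edges \<Delta>) (vperm \<Delta>)"
    and T: "\<And>k. k \<ge> 1 \<Longrightarrow> cyclically_invariant k (T k)"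
    and pos: "centralizer_order m > 0"
  defines "R \<equiv> {C \<in> R00. cycle_type (half_edges (representative C)) (vperm (representative C)) = m}"
  shows "finite R"
    and "(\<Sum>\<pi>\<in>pairings (half_edges \<Delta>). graph_value B T (with_edges \<Delta> \<pi>)) / of_nat (centralizer_order m) =
      (\<Sum>C\<in>R. graph_value B T (representative C) / of_nat (card (Aut (representative C))))"
proof -
  let ?P = "pairings (half_edges \<Delta>)"
  define cls where "cls \<pi> = isomorphism_relation `` {with_edges \<Delta> \<pi>}" for \<pi>
  have graph: "is_ribbon_graph (with_edges \<Delta> \<pi>)" if "\<pi> \<in> ?P" for \<pi>
    by (rule is_ribbon_graph_with_edges[OF \<Delta> that])
  have cls_eq: "cls \<pi> = C \<longleftrightarrow> isomorphic (representative C) (with_edges \<Delta> \<pi>)"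
    if "\<pi> \<in> ?P" "C \<in> R00" for \<pi> C
  proof -
    have "cls \<pi> = C \<longleftrightarrow> isomorphism_relation `` {representative C} = isomorphism_relation `` {with_edges \<Delta> \<pi>}"
      using representative_in(3)[OF that(2)] by (auto simp: cls_def)
    also have "\<dots> \<longleftrightarrow> (representative C, with_edges \<Delta> \<pi>) \<in> isomorphism_relation"
      using equiv_isomorphism_relation graph[OF that(1)] representative_in(2)[OF that(2)]
      by (simp add: eq_equiv_class_iff)
    finally show ?thesis
      using graph[OF that(1)] representative_in(2)[OF that(2)] by (simp add: isomorphism_relation_def)
  qed
  have cls_R: "cls \<pi> \<in> R" if \<pi>: "\<pi> \<in> ?P" for \<pi>
  proof -
    have C: "cls \<pi> \<in> R00" unfolding cls_def R00_eq using graph[OF \<pi>] by (intro quotientI) simp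
    then have "isomorphic (representative (cls \<pi>)) (with_edges \<Delta> \<pi>)" using cls_eq[OF \<pi>] by blast
    then show ?thesis
      using C isomorphic_cycle_type[OF representative_in(2)[OF C], of "with_edges \<Delta> \<pi>"]
      by (simp add: R_def m)
  qed
  have count: "card {\<pi> \<in> ?P. cls \<pi> = C} * card (Aut (representative C)) = centralizer_order m" if C: "C \<in> R" for C
  proof -
    have C': "C \<in> R00" "cycle_type (half_edges (representative C)) (vperm (representative C)) = m"
      using C by (auto simp: R_def)
    have "{\<pi> \<in> ?P. cls \<pi> = C} = {\<pi> \<in> ?P. isomorphic (representative C) (with_edges \<Delta> \<pi>)}"
      using cls_eq C'(1) by auto
    then show ?thesis
      using card_pairings_isomorphic[OF representative_in(2)[OF C'(1)] \<Delta>] C'(2) m by simp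
  qed
  have "R \<subseteq> cls ` ?P"
  proof
    fix C assume C: "C \<in> R"
    have "card {\<pi> \<in> ?P. cls \<pi> = C} \<noteq> 0" using count[OF C] pos by (cases "card {\<pi> \<in> ?P. cls \<pi> = C} = 0") auto
    then show "C \<in> cls ` ?P" by (auto simp: card_eq_0_iff)
  qed
  then show fin: "finite R" using finite_pairings[OF vertex_systemD(1)[OF \<Delta>]] by (meson finite_imageI finite_subset)
  have "(\<Sum>\<pi>\<in>?P. graph_value B T (with_edges \<Delta> \<pi>)) =
      (\<Sum>C\<in>R. \<Sum>\<pi>\<in>{\<pi> \<in> ?P. cls \<pi> = C}. graph_value B T (with_edges \<Delta> \<pi>))"
    using finite_pairings[OF vertex_systemD(1)[OF \<Delta>]] fin cls_R by (intro sum.group[symmetric]) auto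
  also have "\<dots> = (\<Sum>C\<in>R. of_nat (card {\<pi> \<in> ?P. cls \<pi> = C}) * graph_value B T (representative C))"
  proof (intro sum.cong refl)
    fix C assume C: "C \<in> R"
    then have C': "C \<in> R00" by (simp add: R_def)
    have "graph_value B T (with_edges \<Delta> \<pi>) = graph_value B T (representative C)" if "\<pi> \<in> {\<pi> \<in> ?P. cls \<pi> = C}" for \<pi>
      using that cls_eq[of \<pi> C] C' graph[of \<pi>] representative_in(2)[OF C'] T
      by (intro graph_value_isomorphic[symmetric]) auto
    then show "(\<Sum>\<pi>\<in>{\<pi> \<in> ?P. cls \<pi> = C}. graph_value B T (with_edges \<Delta> \<pi>)) =
        of_nat (card {\<pi> \<in> ?P. cls \<pi> = C}) * graph_value B T (representative C)"
      by simp
  qed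
  finally show "(\<Sum>\<pi>\<in>?P. graph_value B T (with_edges \<Delta> \<pi>)) / of_nat (centralizer_order m) =
      (\<Sum>C\<in>R. graph_value B T (representative C) / of_nat (card (Aut (representative C))))"
  proof -
    assume eq: "(\<Sum>\<pi>\<in>?P. graph_value B T (with_edges \<Delta> \<pi>)) =
      (\<Sum>C\<in>R. of_nat (card {\<pi> \<in> ?P. cls \<pi> = C}) * graph_value B T (representative C))"
    have "of_nat (card {\<pi> \<in> ?P. cls \<pi> = C}) * z / of_nat (centralizer_order m) =
        z / of_nat (card (Aut (representative C)))" if C: "C \<in> R" for C and z :: complex
    proof -
      have "card {\<pi> \<in> ?P. cls \<pi> = C} \<noteq> 0" "card (Aut (representative C)) \<noteq> 0"
        using count[OF C] pos by (metis mult_is_0 less_numeral_extra(3))+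
      then show ?thesis unfolding count[OF C, symmetric] of_nat_mult by (simp add: field_simps)
    qed
    then show ?thesis unfolding eq sum_divide_distrib by (intro sum.cong refl) simp
  qed
qed

lemma zero_notin_cycle_type: "is_vertex_system \<Gamma> \<Longrightarrow> 0 \<notin># cycle_type (half_edges \<Gamma>) (vperm \<Gamma>)"
  using vertex_facts(7)[of \<Gamma>] finite_vertices[of \<Gamma>]
  by (fastforce simp: cycle_type_def vertices_def[symmetric])

text \<open>The expansion, coefficient by coefficient. The multiset \<open>m\<close> is realized by a collection of
  vertices with these valences. For this collection the Taylor coefficient is the vertex product
  at a constant vector, divided by the centralizer order.\<close>

theorem (in invariant_measure_space) Gaussian_expansion_coefficient:
  assumes T: "\<And>k. k \<ge> 1 \<Longrightarrow> complex_multilinear k (T k)" "\<And>k. k \<ge> 1 \<Longrightarrow> cyclically_invariant k (T k)"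
  defines "R m \<equiv> {C \<in> R00. cycle_type (half_edges (representative C)) (vperm (representative C)) = m}"
  shows "integrable (gaussian_measure dv) (\<lambda>v. mfps_coeff (mfps_exp (potential T v)) m)"
    and "finite (R m)"
    and "(\<integral>v. mfps_coeff (mfps_exp (potential T v)) m \<partial>gaussian_measure dv) =
      (\<Sum>C\<in>R m. graph_value B T (representative C) / of_nat (card (Aut (representative C))))"
proof -
  have "integrable (gaussian_measure dv) (\<lambda>v. mfps_coeff (mfps_exp (potential T v)) m) \<and> finite (R m) \<and>
    (\<integral>v. mfps_coeff (mfps_exp (potential T v)) m \<partial>gaussian_measure dv) =
      (\<Sum>C\<in>R m. graph_value B T (representative C) / of_nat (card (Aut (representative C))))"
  proof (cases "0 \<in># m")
    case True
    then have "centralizer_order m = 0"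
      unfolding centralizer_order_def by (intro prod_zero) (auto intro!: bexI[of _ 0])
    then have coeff: "mfps_coeff (mfps_exp (potential T v)) m = 0" for v
      by (simp add: coeff_exp_potential)
    have R: "R m = {}"
      using True zero_notin_cycle_type[OF ribbon_vertex_system] representative_in(2) by (auto simp: R_def)
    show ?thesis unfolding coeff R by simp
  next
    case False
    obtain H :: "nat set" and \<sigma> where H: "finite H" "\<sigma> permutes H" "cycle_type H \<sigma> = m"
      by (rule exists_permutation_of_cycle_type[OF False])
    define \<Delta> where "\<Delta> = \<lparr>half_edges = H, vperm = \<sigma>, eperm = id\<rparr>"
    have \<Delta>: "is_vertex_system \<Delta>" "m = cycle_type (half_edges \<Delta>) (vperm \<Delta>)"
      using H by (simp_all add: \<Delta>_def is_vertex_system_def)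
    have coeff: "mfps_coeff (mfps_exp (potential T v)) m =
        vertex_product T \<Delta> (\<lambda>_. v) / of_nat (centralizer_order m)" for v
      by (simp add: coeff_exp_potential vertex_product_const[OF \<Delta>(1)] \<Delta>(2)[symmetric])
    have "integrable (gaussian_measure dv) (\<lambda>v. vertex_product T \<Delta> (\<lambda>_. v))"
      by (rule integral_vertex_product(1)[OF \<Delta>(1) T(1)])
    moreover have "(\<integral>v. vertex_product T \<Delta> (\<lambda>_. v) \<partial>gaussian_measure dv) =
        (\<Sum>\<pi>\<in>pairings (half_edges \<Delta>). graph_value B T (with_edges \<Delta> \<pi>))"
      by (rule integral_vertex_product(2)[OF \<Delta>(1) T(1)])
    ultimately show ?thesis
      using sum_pairings_eq_sum_classes(1)[of \<Delta> m T, OF \<Delta> T(2) centralizer_order_pos[OF False]]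
        sum_pairings_eq_sum_classes(2)[of \<Delta> m T B, OF \<Delta> T(2) centralizer_order_pos[OF False]]
      unfolding coeff R_def by simp
  qed
  then show "integrable (gaussian_measure dv) (\<lambda>v. mfps_coeff (mfps_exp (potential T v)) m)"
    and "finite (R m)"
    and "(\<integral>v. mfps_coeff (mfps_exp (potential T v)) m \<partial>gaussian_measure dv) =
      (\<Sum>C\<in>R m. graph_value B T (representative C) / of_nat (card (Aut (representative C))))"
    by blast+
qed

theorem theorem3p1:
  fixes dv :: "'a::real_inner measure"
    and B :: "'a set"
    and T :: "nat \<Rightarrow> 'a complexification list \<Rightarrow> complex"
  assumes "orthonormal_basis B"
    and "translation_invariant_measure dv"
    and "\<And>k. k \<ge> 1 \<Longrightarrow> complex_multilinear k (T k)"
    and "\<And>k. k \<ge> 1 \<Longrightarrow> cyclically_invariant k (T k)"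
  shows "termwise_integrable (gaussian_measure dv) (\<lambda>v. mfps_exp (potential T v)) \<and>
    formally_summable (\<lambda>C. weight B T (representative C)) R00 \<and>
    termwise_integral (gaussian_measure dv) (\<lambda>v. mfps_exp (potential T v)) =
      formal_sum (\<lambda>C. weight B T (representative C)) R00"
proof -
  interpret invariant_measure_space B dv
    by unfold_locales (rule assms)+
  define R where "R m = {C \<in> R00. cycle_type (half_edges (representative C)) (vperm (representative C)) = m}" for m
  define z where "z C = graph_value B T (representative C) / of_nat (card (Aut (representative C)))" for C
  note expansion = Gaussian_expansion_coefficient[of T, OF assms(3,4), folded R_def z_def]
  have weight: "mfps_coeff (weight B T (representative C)) m = (if C \<in> R m then z C else 0)" if "C \<in> R00" for C m
    using that by (auto simp: coeff_weight[OF representative_in(2)[OF that]] R_def z_def)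
  have support: "{C \<in> R00. mfps_coeff (weight B T (representative C)) m \<noteq> 0} \<subseteq> R m" for m
    using weight by (auto split: if_splits)
  have "termwise_integrable (gaussian_measure dv) (\<lambda>v. mfps_exp (potential T v))"
    unfolding termwise_integrable_def using expansion(1) by blast
  moreover have "formally_summable (\<lambda>C. weight B T (representative C)) R00"
    unfolding formally_summable_def using support expansion(2) finite_subset by blast
  moreover have "termwise_integral (gaussian_measure dv) (\<lambda>v. mfps_exp (potential T v)) =
      formal_sum (\<lambda>C. weight B T (representative C)) R00"
  proof (rule mfps_eqI)
    fix m
    have "mfps_coeff (formal_sum (\<lambda>C. weight B T (representative C)) R00) m =
        (\<Sum>C\<in>{C \<in> R00. mfps_coeff (weight B T (representative C)) m \<noteq> 0}. mfps_coeff (weight B T (representative C)) m)"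
      by (simp add: formal_sum_def)
    also have "\<dots> = (\<Sum>C\<in>R m. mfps_coeff (weight B T (representative C)) m)"
      by (rule sum.mono_neutral_left) (use support expansion(2) in \<open>auto simp: R_def\<close>)
    also have "\<dots> = (\<Sum>C\<in>R m. z C)"
      by (intro sum.cong refl) (use weight in \<open>auto simp: R_def\<close>)
    finally show "mfps_coeff (termwise_integral (gaussian_measure dv) (\<lambda>v. mfps_exp (potential T v))) m =
        mfps_coeff (formal_sum (\<lambda>C. weight B T (representative C)) R00) m"
      by (simp add: termwise_integral_def expansion(3))
  qed
  ultimately show ?thesis by blast
qed

end
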